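(* Let $\mathbf{P}=(P_1,P_2,\dots,P_k)$ be a collection of $d$-dimensional lattice polytopes in $\mathbb{R}^d$. For a positive integer $r$ let $r\mathbf{P}=(rP_1,\dots,rP_k)$, with mixed $h^*$-vector $h^*(r\mathbf{P})=(h_0^*(r\mathbf{P}),\dots,h_d^*(r\mathbf{P}))$ and mixed $h^*$-polynomial $h^*_{r\mathbf{P}}(z)$. Then there exists a positive integer $R$ (depending on $\mathbf{P}$) such that for $r\ge R$: (i) the mixed $h^*$-polynomial $h^*_{r\mathbf{P}}(z)$ has only real roots $\beta^{(1)}(r)<\beta^{(2)}(r)<\cdots<\beta^{(d-1)}(r)<\beta^{(d)}(r)<0$ with $\lim_{r\to\infty}\beta^{(i)}(r)=\rho^{(i)}$ for $1\le i\le d$, where $\rho^{(1)}<\rho^{(2)}<\cdots<\rho^{(d)}=0$ denote the roots of the $d$-th Eulerian polynomial $A_d(z)$; (ii) $h_i^*(r\mathbf{P})>0$ for $1\le i\le d$; (iii) $h^*(r\mathbf{P})$ is log-concave and unimodal.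
   Context: A lattice polytope in $\mathbb{R}^d$ is the convex hull of a nonempty finite subset of $\mathbb{Z}^d$. For $J\subseteq[k]=\{1,\dots,k\}$ put $P_J:=\sum_{j\in J}P_j$ (Minkowski sum), with $P_\emptyset=\{0\}$. For a lattice polytope $P$, $E_P(n)$ is its Ehrhart polynomial, i.e. the polynomial with $E_P(n)=|nP\cap\mathbb{Z}^d|$ for all integers $n\ge 0$. The mixed Ehrhart polynomial of $\mathbf{P}$ is $$\mathrm{ME}_{\mathbf{P}}(n):=\sum_{J\subseteq[k]}(-1)^{k-|J|}E_{P_J}(n),$$ a polynomial of degree at most $d$. The mixed $h^*$-vector $h^*(\mathbf{P})=(h_0^*(\mathbf{P}),\dots,h_d^*(\mathbf{P}))$ is defined by $$\mathrm{ME}_{\mathbf{P}}(n)=\sum_{i=0}^d h_i^*(\mathbf{P})\binom{n+d-i}{d},$$ and the mixed $h^*$-polynomial is $h^*_{\mathbf{P}}(z):=\sum_{i=0}^d h_i^*(\mathbf{P})z^i$. The $d$-th Eulerian polynomial $A_d(z)$ is defined by $$\sum_{n\ge 0}n^dz^n=\frac{A_d(z)}{(1-z)^{d+1}};$$ its roots are known to be real and simple. A sequence $(a_0,\dots,a_d)$ of real numbers is log-concave if $a_i^2\ge a_{i-1}a_{i+1}$ for all $1\le i\le d-1$, and unimodal if there is $0\le\ell\le d$ with $a_0\le\cdots\le a_\ell\ge\cdots\ge a_d$.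
   Formalization: The strict inequality β^(d)(r)<0 is replaced by β^(d)(r)=0, since h_0^*(rP)=0 makes 0 always a root, and 1≤k≤d is assumed, since for k>d the mixed h*-polynomial vanishes and (i),(ii) fail. *)

theory Defs
  imports
    "HOL-Analysis.Analysis"
    "HOL-Library.Set_Algebras"
    "HOL-Computational_Algebra.Computational_Algebra"
begin

text \<open>
  The dimension is \<open>d = CARD('d)\<close>.  Minkowski sums are sums of sets in the sense of
  \<open>Set_Algebras\<close>; in particular the empty sum is \<open>{0}\<close>.
\<close>

definition integer_points :: "(real ^ 'd) set" where
  "integer_points = {x. \<forall>i. x $ i \<in> \<int>}"

definition lattice_polytope :: "(real ^ 'd) set \<Rightarrow> bool" where
  "lattice_polytope P \<longleftrightarrow>
     (\<exists>S. finite S \<and> S \<noteq> {} \<and> S \<subseteq> integer_points \<and> P = convex hull S)"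

definition dilate :: "nat \<Rightarrow> (real ^ 'd) set \<Rightarrow> (real ^ 'd) set" where
  "dilate n P = (\<lambda>x. real n *\<^sub>R x) ` P"

text \<open>
  The definite descriptions below are meant for lattice polytopes, where the polynomial exists by
  Ehrhart's theorem; it is unique because its values at all natural numbers are prescribed.
\<close>

definition ehrhart_poly :: "(real ^ 'd) set \<Rightarrow> real poly" where
  "ehrhart_poly P =
     (THE p. \<forall>n::nat. poly p (real n) = real (card (dilate n P \<inter> integer_points)))"

definition mixed_ehrhart_poly :: "nat \<Rightarrow> (nat \<Rightarrow> (real ^ 'd) set) \<Rightarrow> real poly" where
  "mixed_ehrhart_poly k P =
     (\<Sum>J\<in>Pow {1..k}. smult ((-1) ^ (k - card J)) (ehrhart_poly (\<Sum>j\<in>J. P j)))"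

text \<open>
  The vector \<open>(h\<^sub>0, \<dots>, h\<^sub>d)\<close> is a function on \<open>nat\<close> that vanishes above \<open>d\<close>.
  The subtraction in the binomial coefficient does not truncate, as \<open>i \<le> d\<close>.
\<close>

definition mixed_hstar :: "nat \<Rightarrow> (nat \<Rightarrow> (real ^ 'd) set) \<Rightarrow> nat \<Rightarrow> real" where
  "mixed_hstar k P =
     (THE h. (\<forall>i>CARD('d). h i = 0) \<and>
        (\<forall>n::nat. poly (mixed_ehrhart_poly k P) (real n) =
           (\<Sum>i\<le>CARD('d). h i * real ((n + CARD('d) - i) choose CARD('d)))))"

definition mixed_hstar_poly :: "nat \<Rightarrow> (nat \<Rightarrow> (real ^ 'd) set) \<Rightarrow> real poly" where
  "mixed_hstar_poly k P = (\<Sum>i\<le>CARD('d). monom (mixed_hstar k P i) i)"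

text \<open>The generating function identity is read in the ring of formal power series.\<close>

definition eulerian_poly :: "nat \<Rightarrow> real poly" where
  "eulerian_poly d =
     (THE A. Abs_fps (\<lambda>n. real n ^ d) = fps_of_poly A / (1 - fps_X) ^ (d + 1))"

text \<open>
  The complex zeros of \<open>p\<close> are exactly the reals \<open>x 1 < \<dots> < x m\<close>.  If \<open>p\<close> has degree at most
  \<open>m\<close>, all of them are therefore simple.
\<close>

definition ordered_real_roots :: "real poly \<Rightarrow> nat \<Rightarrow> (nat \<Rightarrow> real) \<Rightarrow> bool" where
  "ordered_real_roots p m x \<longleftrightarrow>
     {z::complex. poly (map_poly complex_of_real p) z = 0} = (\<lambda>i. complex_of_real (x i)) ` {1..m} \<and>
     strict_mono_on {1..m} x"

definition log_concave :: "nat \<Rightarrow> (nat \<Rightarrow> real) \<Rightarrow> bool" where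
  "log_concave d a \<longleftrightarrow> (\<forall>i\<in>{1..<d}. (a i)\<^sup>2 \<ge> a (i - 1) * a (i + 1))"

definition unimodal :: "nat \<Rightarrow> (nat \<Rightarrow> real) \<Rightarrow> bool" where
  "unimodal d a \<longleftrightarrow>
     (\<exists>l\<le>d. (\<forall>i<l. a i \<le> a (i + 1)) \<and> (\<forall>i\<in>{l..<d}. a i \<ge> a (i + 1)))"

end

theory Submission
  imports Defs
begin

text \<open>
  Give the vertices of \<open>P\<^sub>j\<close> the colour \<open>j\<close>. A point of \<open>m\<^sub>1 P\<^sub>1 + \<dots> + m\<^sub>k P\<^sub>k\<close> is a nonnegative
  combination of the vertices in which colour \<open>j\<close> has mass \<open>m\<^sub>j\<close>; among all such representations
  there is a unique lexicographically optimal one for any chosen order and choice of signs of the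
  coordinates, and whether a representation is optimal depends only on its support. (This is a
  regular triangulation of the Cayley polytope.) Splitting the coefficients of the optimal
  representations into integral and fractional parts counts the lattice points of each cell by a
  product of binomial coefficients, one factor for each colour. The resulting formula is a
  polynomial which is valid as long as all \<open>m\<^sub>j\<close> are positive. If a vertex of colour \<open>j\<close> is maximised
  first, then the cells pair up to half-open ones and the count is polynomial in \<open>m\<^sub>j\<close> down to
  \<open>m\<^sub>j = 0\<close>; hence the formula is valid for all \<open>m\<close>. The alternating sum over subsets factors over
  the colours, so only cells with at least two vertices of each colour contribute to the mixed
  Ehrhart polynomial. Every such cell of full dimension contributes positively to the coefficient
  of \<open>n\<^sup>d\<close>, and a suitable order of the coordinates produces one.

  With \<open>c\<^sub>j\<close> the coefficients of the mixed Ehrhart polynomial, the mixed \<open>h\<^sup>*\<close>-polynomial of \<open>rP\<close> is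
  \<open>\<Sum>j. c\<^sub>j r\<^sup>j A\<^sub>j(z) (1 - z)\<^sup>d\<^sup>-\<^sup>j\<close>, and division by \<open>r\<^sup>d\<close> makes it converge to \<open>c\<^sub>d A\<^sub>d(z)\<close>. Since \<open>c\<^sub>0 = 0\<close>,
  a factor \<open>z\<close> splits off. The remaining roots of \<open>A\<^sub>d\<close> are negative and simple, which is detected by sign
  changes and hence survives a small perturbation. Polynomials with only negative roots have
  positive, log-concave coefficients.
\<close>

section \<open>Lexicographically optimal representations\<close>

text \<open>\<open>lexneg L (\<lambda>i. y i - x i)\<close> says that \<open>y\<close> comes before
  \<open>x\<close> when coordinates are compared in the order of \<open>L\<close>, each multiplied
  by its weight. A negative weight thus asks for a large coordinate.\<close>

fun lexneg :: "('i \<times> real) list \<Rightarrow> ('i \<Rightarrow> real) \<Rightarrow> bool" where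
  "lexneg [] \<delta> \<longleftrightarrow> False"
| "lexneg ((i, e) # L) \<delta> \<longleftrightarrow> e * \<delta> i < 0 \<or> \<delta> i = 0 \<and> lexneg L \<delta>"

lemma lexneg_total:
  assumes "0 \<notin> snd ` set L" "i \<in> fst ` set L" "\<delta> i \<noteq> 0"
  shows "lexneg L \<delta> \<or> lexneg L (\<lambda>i. - \<delta> i)"
  using assms
proof (induction L)
  case (Cons a L)
  obtain i0 e where a: "a = (i0, e)" by force
  with Cons show ?case by (cases "\<delta> i0 = 0") (auto simp: mult_less_0_iff not_less le_less)
qed simp

lemma lexneg_scale: "t > 0 \<Longrightarrow> lexneg L (\<lambda>i. t * \<delta> i) = lexneg L \<delta>"
  by (induction L \<delta> rule: lexneg.induct) (auto simp: mult_less_0_iff zero_less_mult_iff)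

text \<open>Minimise the first weighted coordinate and continue in the set of its minimisers, which
  is again compact and nonempty.\<close>

lemma lexmin_exists:
  fixes C :: "('i \<Rightarrow> real) set"
  assumes "compact C" "C \<noteq> {}" "0 \<notin> snd ` set L"
  shows "\<exists>x\<in>C. \<forall>y\<in>C. \<not> lexneg L (\<lambda>i. y i - x i)"
  using assms
proof (induction L arbitrary: C)
  case (Cons a L)
  obtain i e where a: "a = (i, e)" by force
  with Cons.prems have e: "e \<noteq> 0" by force
  have cont: "continuous_on A (\<lambda>x::'i \<Rightarrow> real. e * x i)" for A
    by (intro continuous_intros continuous_on_subset[OF continuous_on_product_coordinates]) auto
  obtain z where z: "z \<in> C" "\<And>y. y \<in> C \<Longrightarrow> e * z i \<le> e * y i"
    using continuous_attains_inf[OF Cons.prems(1,2) cont] by blast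
  define C' where "C' = C \<inter> {x. e * x i = e * z i}"
  have "compact C'"
    unfolding C'_def
    by (intro compact_Int_closed Cons.prems closed_Collect_eq cont continuous_on_const)
  moreover have "C' \<noteq> {}" using z by (auto simp: C'_def)
  ultimately obtain x where x: "x \<in> C'" "\<And>y. y \<in> C' \<Longrightarrow> \<not> lexneg L (\<lambda>i. y i - x i)"
    using Cons.IH[of C'] Cons.prems(3) by auto
  have "\<not> lexneg (a # L) (\<lambda>i. y i - x i)" if "y \<in> C" for y
    using x z(2)[OF that] that e by (auto simp: a C'_def algebra_simps)
  then show ?case using x(1) by (auto simp: C'_def)
qed auto

text \<open>Tychonoff's theorem, transferred to the topology of the function type.\<close>

lemma compact_Pi_UNIV:
  fixes S :: "'i \<Rightarrow> 'b::topological_space set"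
  assumes "\<And>i. compact (S i)"
  shows "compact (Pi UNIV S)"
proof -
  have "compactin (product_topology (\<lambda>i. euclidean) UNIV) (PiE UNIV S)"
    unfolding compactin_PiE using assms by simp
  then show ?thesis
    by (simp add: euclidean_product_topology PiE_UNIV_domain)
qed

section \<open>Coloured points and their optimal representations\<close>

locale coloured_points =
  fixes I :: "'i set" and w :: "'i \<Rightarrow> real ^ 'd" and col :: "'i \<Rightarrow> 'c" and J :: "'c set"
  assumes finI: "finite I" and finJ: "finite J" and colI: "col ` I \<subseteq> J"
    and intw: "w ` I \<subseteq> integer_points"
begin

definition mass :: "('i \<Rightarrow> real) \<Rightarrow> 'c \<Rightarrow> real" where
  "mass \<theta> j = (\<Sum>i | i \<in> I \<and> col i = j. \<theta> i)"

definition pt :: "('i \<Rightarrow> real) \<Rightarrow> real ^ 'd" where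
  "pt \<theta> = (\<Sum>i\<in>I. \<theta> i *\<^sub>R w i)"

text \<open>Coefficients are total functions that vanish off \<open>I\<close>, so that
  representations can be compared as functions.\<close>

definition reps :: "('c \<Rightarrow> real) \<Rightarrow> real ^ 'd \<Rightarrow> ('i \<Rightarrow> real) set" where
  "reps m x = {\<theta>. (\<forall>i. 0 \<le> \<theta> i) \<and> (\<forall>i. i \<notin> I \<longrightarrow> \<theta> i = 0) \<and> (\<forall>j\<in>J. mass \<theta> j = m j) \<and> pt \<theta> = x}"

text \<open>The directions between two representations of the same point with the same
  masses.\<close>

definition ker :: "('i \<Rightarrow> real) set" where
  "ker = {\<delta>. (\<forall>i. i \<notin> I \<longrightarrow> \<delta> i = 0) \<and> (\<forall>j\<in>J. mass \<delta> j = 0) \<and> pt \<delta> = 0}"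

text \<open>Optimality as a condition on the support alone: every direction that improves the order
  lowers a coordinate outside \<open>\<sigma>\<close>, and a representation supported in
  \<open>\<sigma>\<close> is already 0 there.\<close>

definition good :: "('i \<times> real) list \<Rightarrow> 'i set \<Rightarrow> bool" where
  "good L \<sigma> \<longleftrightarrow> (\<forall>\<delta>\<in>ker. lexneg L \<delta> \<longrightarrow> (\<exists>i\<in>I - \<sigma>. \<delta> i < 0))"

lemma mass_add: "mass (\<lambda>i. a i + b i) j = mass a j + mass b j"
  by (simp add: mass_def sum.distrib)

lemma mass_diff: "mass (\<lambda>i. a i - b i) j = mass a j - mass b j"
  by (simp add: mass_def sum_subtractf)

lemma mass_scale: "mass (\<lambda>i. t * b i) j = t * mass b j"
  by (simp add: mass_def sum_distrib_left)

lemma pt_add: "pt (\<lambda>i. a i + b i) = pt a + pt b"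
  by (simp add: pt_def sum.distrib scaleR_add_left)

lemma pt_diff: "pt (\<lambda>i. a i - b i) = pt a - pt b"
  by (simp add: pt_def sum_subtractf scaleR_diff_left)

lemma pt_scale: "pt (\<lambda>i. t * b i) = t *\<^sub>R pt b"
  by (simp add: pt_def scaleR_right.sum)

lemma rep_le_mass:
  assumes "i \<in> I" "\<And>i. i \<in> I \<Longrightarrow> 0 \<le> \<theta> i"
  shows "\<theta> i \<le> mass \<theta> (col i)"
  unfolding mass_def by (rule member_le_sum) (use assms finI in auto)

text \<open>Each coefficient lies between 0 and the mass of its colour, so the representations form
  a closed subset of a product of compact sets.\<close>

lemma compact_reps: "compact (reps m x)"
proof -
  have c: "continuous_on UNIV (\<lambda>\<theta>::'i \<Rightarrow> real. \<theta> i)" for i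
    by (rule continuous_on_product_coordinates)
  define K where "K = Pi UNIV (\<lambda>i. if i \<in> I then {0..m (col i)} else {0})"
  have K: "compact K" unfolding K_def by (intro compact_Pi_UNIV) auto
  have cl: "closed ({\<theta>. pt \<theta> = x} \<inter> (\<Inter>j\<in>J. {\<theta>. mass \<theta> j = m j}))"
    unfolding pt_def mass_def
    by (intro closed_Int closed_INT ballI closed_Collect_eq continuous_on_sum continuous_on_const
        continuous_on_scaleR c)
  have "reps m x = K \<inter> ({\<theta>. pt \<theta> = x} \<inter> (\<Inter>j\<in>J. {\<theta>. mass \<theta> j = m j}))" (is "_ = ?R")
  proof (intro equalityI subsetI)
    fix \<theta> assume l: "\<theta> \<in> reps m x"
    have "\<theta> \<in> K" unfolding K_def
      using l rep_le_mass[of _ \<theta>] colI by (fastforce simp: reps_def)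
    then show "\<theta> \<in> ?R" using l by (auto simp: reps_def)
  next
    fix \<theta> assume l: "\<theta> \<in> ?R"
    then have "0 \<le> \<theta> i" "i \<notin> I \<Longrightarrow> \<theta> i = 0" for i
      unfolding K_def by (force simp: Pi_iff split: if_splits)+
    then show "\<theta> \<in> reps m x" using l by (auto simp: reps_def)
  qed
  then show ?thesis using compact_Int_closed[OF K cl] by simp
qed

text \<open>The support of the lexicographic minimum is good: an improving direction that is
  nonnegative off the support could be followed for a short step without leaving
  \<open>reps m x\<close>.\<close>

lemma good_rep_exists:
  assumes ne: "reps m x \<noteq> {}" and L: "0 \<notin> snd ` set L"
  shows "\<exists>\<theta>\<in>reps m x. good L {i\<in>I. \<theta> i > 0}"
proof -
  obtain \<theta> where l: "\<theta> \<in> reps m x" and min: "\<And>\<mu>. \<mu> \<in> reps m x \<Longrightarrow> \<not> lexneg L (\<lambda>i. \<mu> i - \<theta> i)"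
    using lexmin_exists[OF compact_reps ne L] by blast
  have "\<exists>i\<in>I - {i \<in> I. 0 < \<theta> i}. \<delta> i < 0" if d: "\<delta> \<in> ker" and neg: "lexneg L \<delta>" for \<delta>
  proof (rule ccontr)
    assume nonneg: "\<not> ?thesis"
    \<comment> \<open>Positive coordinates tolerate small steps, and at the others
      \<open>\<delta>\<close> is nonnegative. Since \<open>I\<close> is finite, one step length
      serves all coordinates.\<close>
    have "\<forall>\<^sub>F e in at_right 0. 0 \<le> \<theta> i + e * \<delta> i" if i: "i \<in> I" for i
    proof (cases "\<theta> i > 0")
      case True
      have "((\<lambda>e. \<theta> i + e * \<delta> i) \<longlongrightarrow> \<theta> i + 0 * \<delta> i) (at_right 0)"
        by (intro tendsto_intros)
      with True have "\<forall>\<^sub>F e in at_right 0. 0 < \<theta> i + e * \<delta> i"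
        by (intro order_tendstoD) auto
      then show ?thesis by eventually_elim simp
    next
      case False
      with l i have "\<theta> i = 0" by (auto simp: reps_def order.antisym)
      moreover have "\<delta> i \<ge> 0" using nonneg False i by (auto simp: not_less)
      moreover have "\<forall>\<^sub>F e in at_right (0::real). 0 < e" by (simp add: eventually_at_right_less)
      ultimately show ?thesis by (auto elim!: eventually_mono)
    qed
    then have "\<forall>\<^sub>F e in at_right 0. \<forall>i\<in>I. 0 \<le> \<theta> i + e * \<delta> i"
      by (simp add: eventually_ball_finite_distrib[OF finI])
    moreover have "\<forall>\<^sub>F e in at_right (0::real). 0 < e" by (simp add: eventually_at_right_less)
    ultimately have "\<forall>\<^sub>F e in at_right 0. 0 < e \<and> (\<forall>i\<in>I. 0 \<le> \<theta> i + e * \<delta> i)"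
      by eventually_elim simp
    then obtain e where e: "e > 0" "\<And>i. i \<in> I \<Longrightarrow> 0 \<le> \<theta> i + e * \<delta> i"
      using eventually_happens'[OF trivial_limit_at_right_real] by blast
    have "0 \<le> \<theta> i + e * \<delta> i" for i
      using e(2)[of i] l d by (cases "i \<in> I") (auto simp: reps_def ker_def)
    then have "(\<lambda>i. \<theta> i + e * \<delta> i) \<in> reps m x"
      using l d by (auto simp: reps_def ker_def mass_add pt_add mass_scale pt_scale)
    from min[OF this] have "\<not> lexneg L (\<lambda>i. e * \<delta> i)" by simp
    with neg e(1) show False by (simp add: lexneg_scale)
  qed
  then show ?thesis using l by (auto simp: good_def)
qed

text \<open>Of two different representations one precedes the other. Moving towards the earlier one
  would lower a coordinate that already vanishes, so the earlier one would have a negative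
  coefficient.\<close>

lemma good_rep_unique:
  assumes "\<theta> \<in> reps m x" "\<mu> \<in> reps m x"
    and "good L {i\<in>I. \<theta> i > 0}" "good L {i\<in>I. \<mu> i > 0}"
    and L: "0 \<notin> snd ` set L" "fst ` set L = I"
  shows "\<theta> = \<mu>"
proof (rule ccontr)
  assume "\<theta> \<noteq> \<mu>"
  then obtain i where i: "\<theta> i \<noteq> \<mu> i" by auto
  have "i \<in> I" using i assms(1,2) by (force simp: reps_def)
  with lexneg_total[OF L(1), of i "\<lambda>i. \<theta> i - \<mu> i"] L i
  have "lexneg L (\<lambda>i. \<theta> i - \<mu> i) \<or> lexneg L (\<lambda>i. \<mu> i - \<theta> i)" by simp
  moreover have "\<not> lexneg L (\<lambda>i. \<beta> i - \<alpha> i)"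
    if "\<alpha> \<in> reps m x" "\<beta> \<in> reps m x" "good L {i\<in>I. \<alpha> i > 0}" for \<alpha> \<beta>
  proof
    assume neg: "lexneg L (\<lambda>i. \<beta> i - \<alpha> i)"
    moreover have "(\<lambda>i. \<beta> i - \<alpha> i) \<in> ker"
      using that by (auto simp: reps_def ker_def mass_diff pt_diff)
    ultimately obtain k where "k \<in> I" "\<not> \<alpha> k > 0" "\<beta> k - \<alpha> k < 0"
      using \<open>good L {i\<in>I. \<alpha> i > 0}\<close> unfolding good_def by blast
    moreover have "0 \<le> \<alpha> k" "0 \<le> \<beta> k" using that by (auto simp: reps_def)
    ultimately show False by linarith
  qed
  ultimately show False using assms by blast
qed

lemma good_mono: "good L \<tau> \<Longrightarrow> \<sigma> \<subseteq> \<tau> \<Longrightarrow> good L \<sigma>"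
  unfolding good_def by blast

end

section \<open>Counting lattice points by cells\<close>

text \<open>The hockey-stick identity; it sums over the value of the part that is added in the
  induction on the number of parts.\<close>

lemma sum_choose_offset: "(\<Sum>y\<le>n. (y + t) choose t) = (n + Suc t) choose Suc t"
  by (induction n) simp_all

section \<open>Weak compositions\<close>

definition compositions :: "'i set \<Rightarrow> nat \<Rightarrow> ('i \<Rightarrow> nat) set" where
  "compositions T n = {\<mu>. (\<forall>i. i \<notin> T \<longrightarrow> \<mu> i = 0) \<and> sum \<mu> T = n}"

lemma compositions_empty: "compositions {} n = (if n = 0 then {\<lambda>_. 0} else {})"
  by (auto simp: compositions_def)

lemma compositions_insert:
  assumes "finite T" "a \<notin> T"
  shows "compositions (insert a T) n = (\<lambda>(x, \<mu>). \<mu>(a := x)) ` (SIGMA x:{..n}. compositions T (n - x))"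
    (is "_ = ?R")
proof (intro equalityI subsetI)
  fix \<mu> assume m: "\<mu> \<in> compositions (insert a T) n"
  have "sum (\<mu>(a := 0)) T = sum \<mu> T" by (rule sum.cong) (use assms in auto)
  with m assms have "(\<mu> a, \<mu>(a := 0)) \<in> (SIGMA x:{..n}. compositions T (n - x))"
    by (auto simp: compositions_def)
  moreover have "\<mu> = (\<lambda>(x, \<mu>). \<mu>(a := x)) (\<mu> a, \<mu>(a := 0))" by auto
  ultimately show "\<mu> \<in> ?R" by blast
next
  fix \<mu> assume "\<mu> \<in> ?R"
  then obtain x \<nu> where x: "x \<le> n" "\<nu> \<in> compositions T (n - x)" "\<mu> = \<nu>(a := x)" by auto
  have "sum (\<nu>(a := x)) T = sum \<nu> T" by (rule sum.cong) (use assms in auto)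
  then show "\<mu> \<in> compositions (insert a T) n" using x assms by (auto simp: compositions_def)
qed

lemma finite_compositions: "finite T \<Longrightarrow> finite (compositions T n)"
  by (induction T arbitrary: n rule: finite_induct) (auto simp: compositions_empty compositions_insert)

text \<open>Stars and bars. The case \<open>t = 0\<close> is separate because \<open>t - 1\<close>
  would truncate.\<close>

definition wcount :: "nat \<Rightarrow> nat \<Rightarrow> nat" where
  "wcount t n = (if t = 0 then (if n = 0 then 1 else 0) else (n + (t - 1)) choose (t - 1))"

lemma card_compositions: "finite T \<Longrightarrow> card (compositions T n) = wcount (card T) n"
proof (induction T arbitrary: n rule: finite_induct)
  case empty
  then show ?case by (simp add: compositions_empty wcount_def)
next
  case (insert a T)
  have inj: "inj_on (\<lambda>(x, \<mu>). \<mu>(a := x)) (SIGMA x:{..n}. compositions T (n - x))"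
  proof (rule inj_onI, clarify)
    fix x \<mu> y \<nu> assume *: "\<mu> \<in> compositions T (n - x)" "\<nu> \<in> compositions T (n - y)" "\<mu>(a := x) = \<nu>(a := y)"
    have "\<mu> i = \<nu> i" for i
      using fun_cong[OF *(3), of i] *(1,2) insert.hyps by (cases "i = a") (auto simp: compositions_def)
    then show "x = y \<and> \<mu> = \<nu>" using fun_cong[OF *(3), of a] by auto
  qed
  have "card (compositions (insert a T) n) = (\<Sum>x\<le>n. wcount (card T) (n - x))"
    using insert by (simp add: compositions_insert card_image[OF inj] finite_compositions)
  also have "\<dots> = (\<Sum>x\<le>n. wcount (card T) x)"
    by (rule sum.reindex_bij_witness[of _ "\<lambda>x. n - x" "\<lambda>x. n - x"]) auto
  also have "\<dots> = wcount (Suc (card T)) n"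
  proof (cases "card T")
    case 0
    have "(\<Sum>x\<le>n. if x = 0 then 1 else 0) = (1::nat)" by (subst sum.delta) auto
    then show ?thesis using 0 by (simp add: wcount_def)
  next
    case (Suc t)
    then show ?thesis using sum_choose_offset[of t n] by (simp add: wcount_def)
  qed
  finally show ?case using insert by simp
qed

lemma finite_bounded_integer_points:
  "finite {x :: real ^ 'd. x \<in> integer_points \<and> norm x \<le> B}"
proof -
  let ?F = "{z::real. z \<in> \<int> \<and> - B \<le> z \<and> z \<le> B}"
  have "finite (vec_lambda ` (PiE (UNIV :: 'd set) (\<lambda>_. ?F)))"
    by (intro finite_imageI finite_PiE finite_int_segment) auto
  moreover have "{x :: real ^ 'd. x \<in> integer_points \<and> norm x \<le> B} \<subseteq> vec_lambda ` (PiE UNIV (\<lambda>_. ?F))"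
  proof
    fix x :: "real ^ 'd" assume x: "x \<in> {x. x \<in> integer_points \<and> norm x \<le> B}"
    have "- B \<le> vec_nth x i \<and> vec_nth x i \<le> B" for i
      using x component_le_norm_cart[of x i] by (simp add: abs_le_iff)
    then have "vec_nth x \<in> PiE UNIV (\<lambda>_. ?F)"
      using x by (simp add: integer_points_def PiE_UNIV_domain)
    moreover have "x = vec_lambda (vec_nth x)" by simp
    ultimately show "x \<in> vec_lambda ` (PiE UNIV (\<lambda>_. ?F))" by blast
  qed
  ultimately show ?thesis by (rule rev_finite_subset)
qed

lemma integer_points_add: "x \<in> integer_points \<Longrightarrow> y \<in> integer_points \<Longrightarrow> x + y \<in> integer_points"
  by (auto simp: integer_points_def)

lemma integer_points_diff: "x \<in> integer_points \<Longrightarrow> y \<in> integer_points \<Longrightarrow> x - y \<in> integer_points"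
  by (auto simp: integer_points_def)

lemma integer_points_scale: "x \<in> integer_points \<Longrightarrow> real n *\<^sub>R x \<in> integer_points"
  by (auto simp: integer_points_def)

lemma integer_points_sum: "(\<And>i. i \<in> A \<Longrightarrow> f i \<in> integer_points) \<Longrightarrow> sum f A \<in> integer_points"
  by (auto simp: integer_points_def)

section \<open>Cells of the triangulation\<close>

context coloured_points
begin

text \<open>Coordinates in \<open>\<tau>\<close> are strictly positive, those in
  \<open>\<upsilon>\<close> may vanish: \<open>\<upsilon> = {}\<close> gives a relatively open cell,
  and a single element in \<open>\<upsilon>\<close> gives a half-open one.\<close>

definition cell :: "'i set \<Rightarrow> 'i set \<Rightarrow> ('c \<Rightarrow> nat) \<Rightarrow> ('i \<Rightarrow> real) set" where
  "cell \<tau> \<upsilon> m = {\<theta>. (\<forall>i\<in>\<tau>. 0 < \<theta> i) \<and> (\<forall>i\<in>\<upsilon>. 0 \<le> \<theta> i) \<and> (\<forall>i. i \<notin> \<tau> \<union> \<upsilon> \<longrightarrow> \<theta> i = 0) \<and>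
     (\<forall>j\<in>J. mass \<theta> j = real (m j)) \<and> pt \<theta> \<in> integer_points}"

definition pts :: "('c \<Rightarrow> nat) \<Rightarrow> (real ^ 'd) set" where
  "pts m = {x \<in> integer_points. reps (\<lambda>j. real (m j)) x \<noteq> {}}"

lemma finite_pts: "finite (pts m)"
proof -
  have "norm x \<le> (\<Sum>i\<in>I. real (m (col i)) * norm (w i))" if x: "x \<in> pts m" for x
  proof -
    obtain \<theta> where t: "\<theta> \<in> reps (\<lambda>j. real (m j)) x" using x unfolding pts_def by blast
    have "norm x = norm (\<Sum>i\<in>I. \<theta> i *\<^sub>R w i)" using t by (simp add: reps_def pt_def)
    also have "\<dots> \<le> (\<Sum>i\<in>I. norm (\<theta> i *\<^sub>R w i))" by (rule norm_sum)
    also have "\<dots> \<le> (\<Sum>i\<in>I. real (m (col i)) * norm (w i))"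
    proof (rule sum_mono)
      fix i assume i: "i \<in> I"
      then have "\<theta> i \<le> real (m (col i))" "0 \<le> \<theta> i"
        using rep_le_mass[OF i, of \<theta>] t colI by (auto simp: reps_def image_subset_iff)
      then show "norm (\<theta> i *\<^sub>R w i) \<le> real (m (col i)) * norm (w i)"
        by (simp add: mult_right_mono)
    qed
    finally show ?thesis .
  qed
  then have "pts m \<subseteq> {x. x \<in> integer_points \<and> norm x \<le> (\<Sum>i\<in>I. real (m (col i)) * norm (w i))}"
    by (auto simp: pts_def)
  then show ?thesis using finite_bounded_integer_points finite_subset by blast
qed

lemma cell_imp_rep:
  assumes "\<theta> \<in> cell \<tau> \<upsilon> m" "\<tau> \<union> \<upsilon> \<subseteq> I"
  shows "\<theta> \<in> reps (\<lambda>j. real (m j)) (pt \<theta>)"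
proof -
  have "0 \<le> \<theta> i" for i
    using assms(1) by (cases "i \<in> \<tau> \<union> \<upsilon>") (auto simp: cell_def intro: less_imp_le)
  then show ?thesis using assms by (auto simp: reps_def cell_def)
qed

lemma cell_supp: "\<theta> \<in> cell \<tau> \<upsilon> m \<Longrightarrow> {i\<in>I. \<theta> i > 0} \<subseteq> \<tau> \<union> \<upsilon>"
  by (auto simp: cell_def)

lemma pt_cell: "\<theta> \<in> cell \<tau> \<upsilon> m \<Longrightarrow> \<tau> \<union> \<upsilon> \<subseteq> I \<Longrightarrow> pt \<theta> \<in> pts m"
  using cell_imp_rep[of \<theta> \<tau> \<upsilon> m] unfolding pts_def cell_def by blast

text \<open>Supports inside a good set are good, so uniqueness of optimal representations applies.
  The elements of \<open>C\<close> may come from different cells, which covers single cells and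
  unions alike.\<close>

lemma inj_on_pt_good_cells:
  assumes L: "0 \<notin> snd ` set L" "fst ` set L = I"
    and C: "\<And>\<theta>. \<theta> \<in> C \<Longrightarrow> \<exists>\<tau> \<upsilon>. \<theta> \<in> cell \<tau> \<upsilon> m \<and> \<tau> \<union> \<upsilon> \<subseteq> I \<and> good L (\<tau> \<union> \<upsilon>)"
  shows "inj_on pt C"
proof (rule inj_onI)
  fix a b assume a: "a \<in> C" and b: "b \<in> C" and eq: "pt a = pt b"
  have *: "\<theta> \<in> reps (\<lambda>j. real (m j)) (pt \<theta>) \<and> good L {i\<in>I. \<theta> i > 0}" if t: "\<theta> \<in> C" for \<theta>
  proof -
    obtain \<tau> \<upsilon> where "\<theta> \<in> cell \<tau> \<upsilon> m" "\<tau> \<union> \<upsilon> \<subseteq> I" "good L (\<tau> \<union> \<upsilon>)"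
      using C[OF t] by blast
    then show ?thesis using cell_imp_rep good_mono[OF _ cell_supp] by blast
  qed
  show "a = b"
    using good_rep_unique[OF _ _ _ _ L, of a "\<lambda>j. real (m j)" "pt a" b] *[OF a] *[OF b] eq by simp
qed

lemma finite_cell:
  assumes L: "0 \<notin> snd ` set L" "fst ` set L = I" and "\<tau> \<union> \<upsilon> \<subseteq> I" "good L (\<tau> \<union> \<upsilon>)"
  shows "finite (cell \<tau> \<upsilon> m)"
proof (rule inj_on_finite)
  show "inj_on pt (cell \<tau> \<upsilon> m)"
    by (rule inj_on_pt_good_cells[OF L]) (use assms in blast)
  show "pt ` cell \<tau> \<upsilon> m \<subseteq> pts m" using pt_cell assms by blast
qed (rule finite_pts)

text \<open>Every lattice point has exactly one optimal representation, and this lies in the open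
  cell of its support.\<close>

lemma card_pts_eq_sum_cells:
  assumes L: "0 \<notin> snd ` set L" "fst ` set L = I"
  shows "card (pts m) = (\<Sum>\<sigma> | \<sigma> \<subseteq> I \<and> good L \<sigma>. card (cell \<sigma> {} m))"
proof -
  let ?C = "\<Union>\<sigma>\<in>{\<sigma>. \<sigma> \<subseteq> I \<and> good L \<sigma>}. cell \<sigma> {} m"
  have inj: "inj_on pt ?C"
  proof (rule inj_on_pt_good_cells[OF L])
    fix \<theta> assume "\<theta> \<in> ?C"
    then obtain \<sigma> where "\<theta> \<in> cell \<sigma> {} m" "\<sigma> \<subseteq> I" "good L \<sigma>" by blast
    then show "\<exists>\<tau> \<upsilon>. \<theta> \<in> cell \<tau> \<upsilon> m \<and> \<tau> \<union> \<upsilon> \<subseteq> I \<and> good L (\<tau> \<union> \<upsilon>)"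
      by (intro exI[of _ \<sigma>] exI[of _ "{}"]) simp
  qed
  have "pt ` ?C = pts m"
  proof (intro equalityI subsetI)
    fix x assume x: "x \<in> pts m"
    then have "reps (\<lambda>j. real (m j)) x \<noteq> {}" by (simp add: pts_def)
    then obtain \<theta> where t: "\<theta> \<in> reps (\<lambda>j. real (m j)) x" "good L {i\<in>I. \<theta> i > 0}"
      using good_rep_exists[OF _ L(1)] by blast
    have "\<theta> i = 0" if "i \<notin> {i\<in>I. \<theta> i > 0}" for i
      using t(1) that by (cases "i \<in> I") (auto simp: reps_def order.antisym not_less)
    then have "\<theta> \<in> cell {i\<in>I. \<theta> i > 0} {} m"
      using t(1) x by (simp add: cell_def reps_def pts_def)
    then have "\<theta> \<in> ?C" using t(2) by (intro UN_I[of "{i\<in>I. \<theta> i > 0}"]) auto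
    moreover have "pt \<theta> = x" using t(1) by (simp add: reps_def)
    ultimately show "x \<in> pt ` ?C" by (intro image_eqI[of _ _ \<theta>]) auto
  next
    fix x assume "x \<in> pt ` ?C"
    then show "x \<in> pts m" using pt_cell[of _ _ "{}"] by force
  qed
  then have "card (pts m) = card ?C" using card_image[OF inj] by simp
  also have "\<dots> = (\<Sum>\<sigma> | \<sigma> \<subseteq> I \<and> good L \<sigma>. card (cell \<sigma> {} m))"
  proof (rule card_UN_disjoint)
    show "finite {\<sigma>. \<sigma> \<subseteq> I \<and> good L \<sigma>}" using finI by simp
    show "\<forall>\<sigma>\<in>{\<sigma>. \<sigma> \<subseteq> I \<and> good L \<sigma>}. finite (cell \<sigma> {} m)" using finite_cell[OF L] by auto
    \<comment> \<open>An element of an open cell determines the cell through its support, so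
      distinct cells are disjoint.\<close>
    have "\<sigma> = {i. \<theta> i \<noteq> 0}" if "\<theta> \<in> cell \<sigma> {} m" for \<theta> \<sigma> using that by (force simp: cell_def)
    then show "\<forall>\<sigma>\<in>{\<sigma>. \<sigma> \<subseteq> I \<and> good L \<sigma>}. \<forall>\<tau>\<in>{\<sigma>. \<sigma> \<subseteq> I \<and> good L \<sigma>}.
        \<sigma> \<noteq> \<tau> \<longrightarrow> cell \<sigma> {} m \<inter> cell \<tau> {} m = {}" by blast
  qed
  finally show ?thesis .
qed

text \<open>The assumption \<open>cone\<close> says that the triangulation is a cone with apex
  \<open>v\<close>. The good sets then come in pairs \<open>\<sigma>\<close>,
  \<open>insert v \<sigma>\<close>, and the two open cells of a pair together form the cell in which
  the coordinate of \<open>v\<close> may vanish.\<close>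

lemma card_pts_eq_sum_half_open:
  assumes L: "0 \<notin> snd ` set L" "fst ` set L = I" and v: "v \<in> I"
    and cone: "\<And>\<sigma>. \<sigma> \<subseteq> I \<Longrightarrow> good L \<sigma> \<Longrightarrow> good L (insert v \<sigma>)"
  shows "card (pts m) = (\<Sum>\<sigma> | \<sigma> \<subseteq> I \<and> good L \<sigma> \<and> v \<notin> \<sigma>. card (cell \<sigma> {v} m))"
proof -
  let ?G = "{\<sigma>. \<sigma> \<subseteq> I \<and> good L \<sigma>}" and ?H = "{\<sigma>. \<sigma> \<subseteq> I \<and> good L \<sigma> \<and> v \<notin> \<sigma>}"
  have fin: "finite ?H" using finI by simp
  have G: "?G = ?H \<union> insert v ` ?H"
  proof (intro equalityI subsetI)
    fix \<sigma> assume s: "\<sigma> \<in> ?G"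
    show "\<sigma> \<in> ?H \<union> insert v ` ?H"
    proof (cases "v \<in> \<sigma>")
      case True
      then have "\<sigma> = insert v (\<sigma> - {v})" by auto
      moreover have "\<sigma> - {v} \<in> ?H" using s good_mono by blast
      ultimately show ?thesis by blast
    qed (use s in auto)
  next
    fix \<sigma> assume "\<sigma> \<in> ?H \<union> insert v ` ?H"
    then obtain \<tau> where t: "\<tau> \<subseteq> I" "good L \<tau>" "\<sigma> = \<tau> \<or> \<sigma> = insert v \<tau>" by auto
    have "\<sigma> \<subseteq> I" using t(1,3) v by auto
    moreover have "good L \<sigma>" using t(3)
    proof
      assume "\<sigma> = insert v \<tau>"
      then show "good L \<sigma>" using cone[OF t(1,2)] by simp
    qed (use t(2) in simp)
    ultimately show "\<sigma> \<in> ?G" by simp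
  qed
  have inj: "inj_on (insert v) ?H" by (rule inj_onI) (simp add: insert_ident)
  have half: "card (cell \<sigma> {v} m) = card (cell \<sigma> {} m) + card (cell (insert v \<sigma>) {} m)" if "\<sigma> \<in> ?H" for \<sigma>
  proof -
    have "cell \<sigma> {v} m = cell \<sigma> {} m \<union> cell (insert v \<sigma>) {} m"
      using that by (auto simp: cell_def less_le)
    moreover have "cell \<sigma> {} m \<inter> cell (insert v \<sigma>) {} m = {}"
      using that by (auto simp: cell_def)
    moreover have "finite (cell \<sigma> {} m)" "finite (cell (insert v \<sigma>) {} m)"
      using that cone[of \<sigma>] v by (auto intro!: finite_cell[OF L])
    ultimately show ?thesis by (simp add: card_Un_disjoint)
  qed
  have "card (pts m) = (\<Sum>\<sigma>\<in>?H. card (cell \<sigma> {} m)) + (\<Sum>\<sigma>\<in>insert v ` ?H. card (cell \<sigma> {} m))"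
    unfolding card_pts_eq_sum_cells[OF L] G by (rule sum.union_disjoint) (use fin in auto)
  also have "(\<Sum>\<sigma>\<in>insert v ` ?H. card (cell \<sigma> {} m)) = (\<Sum>\<sigma>\<in>?H. card (cell (insert v \<sigma>) {} m))"
    by (simp add: sum.reindex[OF inj])
  finally show ?thesis using half by (simp add: sum.distrib)
qed

end

section \<open>Binomial polynomials\<close>

text \<open>Counts the integral parts left for \<open>t\<close> points of one colour with mass
  \<open>n\<close> once the fractional parts have used up \<open>s\<close>. For \<open>n < s\<close>
  there are none, whereas \<open>n - s\<close> would truncate.\<close>

definition shifted_wcount :: "nat \<Rightarrow> nat \<Rightarrow> nat \<Rightarrow> nat" where
  "shifted_wcount t s n = (if s \<le> n then wcount t (n - s) else 0)"

text \<open>The binomial coefficient of \<open>n + a - s\<close> over \<open>a\<close> as a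
  polynomial in \<open>n\<close>.\<close>

definition binom_poly :: "nat \<Rightarrow> nat \<Rightarrow> real poly" where
  "binom_poly a s = smult (1 / fact a) (\<Prod>i<a. [:real a - real s - real i, 1:])"

lemma poly_binom_poly:
  assumes "s \<le> n + a"
  shows "poly (binom_poly a s) (real n) = real ((n + a - s) choose a)"
proof -
  have "real ((n + a - s) choose a) = (\<Prod>i=0..<a. real (n + a - s) - real i) / fact a"
    by (simp add: binomial_gbinomial gbinomial_prod_rev)
  also have "real (n + a - s) = real n + real a - real s"
    using assms by simp
  finally show ?thesis
    by (simp add: binom_poly_def poly_prod atLeast0LessThan algebra_simps)
qed

lemma degree_binom_poly: "degree (binom_poly a s) = a"
  by (simp add: binom_poly_def degree_prod_eq_sum_degree)

lemma lead_coeff_binom_poly: "lead_coeff (binom_poly a s) = 1 / fact a"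
  by (simp add: binom_poly_def lead_coeff_smult lead_coeff_prod)

text \<open>The polynomial agrees with the count slightly below \<open>n = s\<close>: for
  \<open>n < s \<le> n + (t - 1)\<close> the argument \<open>n\<close> is one of its zeros.\<close>

lemma shifted_wcount_eq_poly:
  assumes "t \<ge> 1" "s \<le> n + (t - 1)"
  shows "real (shifted_wcount t s n) = poly (binom_poly (t - 1) s) (real n)"
proof (cases "s \<le> n")
  case True
  then have "n - s + (t - 1) = n + (t - 1) - s" by simp
  then show ?thesis using True assms
    by (simp add: poly_binom_poly shifted_wcount_def wcount_def)
next
  case False
  then have "n + (t - 1) - s < t - 1" using assms by linarith
  then show ?thesis using False assms
    by (simp add: poly_binom_poly shifted_wcount_def binomial_eq_0)
qed

section \<open>Fractional and integral parts\<close>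

context coloured_points
begin

definition colour_class :: "'i set \<Rightarrow> 'c \<Rightarrow> 'i set" where
  "colour_class T j = {i \<in> T. col i = j}"

text \<open>Fractional parts lie in \<open>(0, 1]\<close> on \<open>\<tau>\<close> and in
  \<open>[0, 1)\<close> on \<open>\<upsilon>\<close>, so that adding natural numbers reaches every
  positive, respectively nonnegative, coefficient exactly once.\<close>

definition unit_box :: "'i set \<Rightarrow> 'i set \<Rightarrow> ('i \<Rightarrow> real) set" where
  "unit_box \<tau> \<upsilon> = {b. (\<forall>i\<in>\<tau>. 0 < b i \<and> b i \<le> 1) \<and> (\<forall>i\<in>\<upsilon>. 0 \<le> b i \<and> b i < 1) \<and>
     (\<forall>i. i \<notin> \<tau> \<union> \<upsilon> \<longrightarrow> b i = 0) \<and> (\<forall>j\<in>J. mass b j \<in> \<int>) \<and> pt b \<in> integer_points}"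

text \<open>On the box the mass is a nonnegative integer; \<open>nat\<close> and the floor only
  change its type.\<close>

definition shift :: "('i \<Rightarrow> real) \<Rightarrow> 'c \<Rightarrow> nat" where
  "shift b j = nat \<lfloor>mass b j\<rfloor>"

lemma mass_colour_class:
  assumes "T \<subseteq> I" "\<And>i. i \<notin> T \<Longrightarrow> b i = 0"
  shows "mass b j = sum b (colour_class T j)"
  unfolding mass_def colour_class_def
  by (rule sum.mono_neutral_right) (use assms finI in auto)

lemma finite_colour_class: "T \<subseteq> I \<Longrightarrow> finite (colour_class T j)"
  by (rule finite_subset[OF _ finI]) (auto simp: colour_class_def)

definition fibre :: "'i set \<Rightarrow> ('c \<Rightarrow> nat) \<Rightarrow> ('i \<Rightarrow> nat) set" where
  "fibre T n = {\<mu>. (\<forall>i. i \<notin> T \<longrightarrow> \<mu> i = 0) \<and> (\<forall>j\<in>J. sum \<mu> (colour_class T j) = n j)}"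

text \<open>The mass conditions of different colours do not interact, so the integral parts amount
  to one composition for each colour.\<close>

lemma fibre_bij:
  assumes T: "T \<subseteq> I"
  shows "bij_betw (\<lambda>\<mu>. \<lambda>j\<in>J. \<lambda>i. if i \<in> colour_class T j then \<mu> i else 0) (fibre T n)
    (PiE J (\<lambda>j. compositions (colour_class T j) (n j)))"
proof (rule bij_betw_byWitness[where f' = "\<lambda>F i. if i \<in> T then F (col i) i else 0"])
  have cT: "col i \<in> J" if "i \<in> T" for i using that T colI by auto
  show "\<forall>\<mu>\<in>fibre T n. (\<lambda>i. if i \<in> T
      then (\<lambda>j\<in>J. \<lambda>i. if i \<in> colour_class T j then \<mu> i else 0) (col i) i else 0) = \<mu>"
    using cT by (auto simp: fibre_def colour_class_def)
  show "\<forall>F\<in>PiE J (\<lambda>j. compositions (colour_class T j) (n j)).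
      (\<lambda>j\<in>J. \<lambda>i. if i \<in> colour_class T j then if i \<in> T then F (col i) i else 0 else 0) = F"
  proof
    fix F assume F: "F \<in> PiE J (\<lambda>j. compositions (colour_class T j) (n j))"
    show "(\<lambda>j\<in>J. \<lambda>i. if i \<in> colour_class T j then if i \<in> T then F (col i) i else 0 else 0) = F"
    proof (rule ext)
      fix j
      show "(\<lambda>j\<in>J. \<lambda>i. if i \<in> colour_class T j then if i \<in> T then F (col i) i else 0 else 0) j = F j"
      proof (cases "j \<in> J")
        case True
        then have "F j i = 0" if "i \<notin> colour_class T j" for i
          using F that by (auto simp: PiE_iff compositions_def)
        then show ?thesis using True by (auto simp: colour_class_def)
      next
        case False
        then show ?thesis using PiE_arb[OF F] by simp
      qed
    qed
  qed
  have "sum (\<lambda>i. if i \<in> colour_class T j then \<mu> i else 0) (colour_class T j) = sum \<mu> (colour_class T j)"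
    for \<mu> :: "'i \<Rightarrow> nat" and j by (rule sum.cong) auto
  then show "(\<lambda>\<mu>. \<lambda>j\<in>J. \<lambda>i. if i \<in> colour_class T j then \<mu> i else 0) ` fibre T n
      \<subseteq> PiE J (\<lambda>j. compositions (colour_class T j) (n j))"
    by (auto simp: fibre_def compositions_def PiE_iff)
  have "sum (\<lambda>i. if i \<in> T then F (col i) i else 0) (colour_class T j) = sum (F j) (colour_class T j)"
    for F :: "'c \<Rightarrow> 'i \<Rightarrow> nat" and j by (rule sum.cong) (auto simp: colour_class_def)
  then show "(\<lambda>F i. if i \<in> T then F (col i) i else 0) `
      PiE J (\<lambda>j. compositions (colour_class T j) (n j)) \<subseteq> fibre T n"
    by (auto simp: fibre_def compositions_def PiE_iff)
qed

lemma card_fibre: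
  assumes "T \<subseteq> I"
  shows "card (fibre T n) = (\<Prod>j\<in>J. wcount (card (colour_class T j)) (n j))"
  using bij_betw_same_card[OF fibre_bij[OF assms]] finJ
  by (simp add: card_PiE card_compositions finite_colour_class assms)

lemma finite_fibre: "T \<subseteq> I \<Longrightarrow> finite (fibre T n)"
  using bij_betw_finite[OF fibre_bij] finJ
  by (simp add: finite_PiE finite_compositions finite_colour_class)

lemma unit_box_nonneg: "b \<in> unit_box \<tau> \<upsilon> \<Longrightarrow> 0 \<le> b i"
  by (cases "i \<in> \<tau> \<union> \<upsilon>") (auto simp: unit_box_def intro: less_imp_le)

lemma unit_box_supp: "b \<in> unit_box \<tau> \<upsilon> \<Longrightarrow> i \<notin> \<tau> \<union> \<upsilon> \<Longrightarrow> b i = 0"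
  by (simp add: unit_box_def)

lemma unit_box_mass: "b \<in> unit_box \<tau> \<upsilon> \<Longrightarrow> j \<in> J \<Longrightarrow> mass b j = real (shift b j)"
proof -
  assume b: "b \<in> unit_box \<tau> \<upsilon>" "j \<in> J"
  have "mass b j \<ge> 0" unfolding mass_def by (intro sum_nonneg) (use unit_box_nonneg[OF b(1)] in auto)
  moreover have "mass b j \<in> \<int>" using b by (simp add: unit_box_def)
  ultimately show ?thesis unfolding shift_def by (auto elim!: Ints_cases)
qed

lemma unit_box_mass_sum:
  assumes "b \<in> unit_box \<tau> \<upsilon>" "\<tau> \<union> \<upsilon> \<subseteq> I"
  shows "mass b j = sum b (colour_class (\<tau> \<union> \<upsilon>) j)"
  by (rule mass_colour_class[OF assms(2)]) (rule unit_box_supp[OF assms(1)])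

lemma shift_le:
  assumes "b \<in> unit_box \<tau> \<upsilon>" "j \<in> J" "\<tau> \<union> \<upsilon> \<subseteq> I"
  shows "shift b j \<le> card (colour_class (\<tau> \<union> \<upsilon>) j)"
proof -
  have "mass b j \<le> (\<Sum>i\<in>colour_class (\<tau> \<union> \<upsilon>) j. 1)"
    unfolding unit_box_mass_sum[OF assms(1,3)]
    by (rule sum_mono) (use assms(1) in \<open>auto simp: unit_box_def colour_class_def intro: less_imp_le\<close>)
  then show ?thesis using unit_box_mass[OF assms(1,2)] by simp
qed

end

context coloured_points
begin

text \<open>The coordinate of \<open>v\<close> in the box is strictly below 1. This strictness is
  what makes the polynomial count valid at mass 0 as well.\<close>

lemma shift_less:
  assumes b: "b \<in> unit_box \<tau> \<upsilon>" and j: "j \<in> J" and T: "\<tau> \<union> \<upsilon> \<subseteq> I" and v: "v \<in> \<upsilon>" "col v = j"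
  shows "shift b j < card (colour_class (\<tau> \<union> \<upsilon>) j)"
proof -
  have "mass b j < (\<Sum>i\<in>colour_class (\<tau> \<union> \<upsilon>) j. 1)"
    unfolding unit_box_mass_sum[OF b T]
  proof (rule sum_strict_mono_ex1)
    show "\<forall>i\<in>colour_class (\<tau> \<union> \<upsilon>) j. b i \<le> 1"
      using b by (auto simp: unit_box_def colour_class_def intro: less_imp_le)
    show "\<exists>i\<in>colour_class (\<tau> \<union> \<upsilon>) j. b i < 1"
      using b v by (auto simp: unit_box_def colour_class_def intro!: bexI[of _ v])
  qed (rule finite_colour_class[OF T])
  then show ?thesis using unit_box_mass[OF b j] by simp
qed

text \<open>A point of the box is a point of the cell with the same masses; each such cell is finite
  and only finitely many masses occur.\<close>

lemma finite_unit_box: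
  assumes L: "0 \<notin> snd ` set L" "fst ` set L = I" and T: "\<tau> \<union> \<upsilon> \<subseteq> I" and g: "good L (\<tau> \<union> \<upsilon>)"
  shows "finite (unit_box \<tau> \<upsilon>)"
proof (rule finite_subset)
  show "unit_box \<tau> \<upsilon> \<subseteq> (\<Union>s\<in>PiE J (\<lambda>_. {..card I}). cell \<tau> \<upsilon> s)"
  proof
    fix b assume b: "b \<in> unit_box \<tau> \<upsilon>"
    have "shift b j \<le> card I" if "j \<in> J" for j
    proof -
      have "card (colour_class (\<tau> \<union> \<upsilon>) j) \<le> card I"
        by (rule card_mono[OF finI]) (use T in \<open>auto simp: colour_class_def\<close>)
      then show ?thesis using shift_le[OF b that T] by linarith
    qed
    then have "restrict (shift b) J \<in> PiE J (\<lambda>_. {..card I})" by auto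
    moreover have "b \<in> cell \<tau> \<upsilon> (restrict (shift b) J)"
      using b unit_box_mass[OF b] by (auto simp: cell_def unit_box_def)
    ultimately show "b \<in> (\<Union>s\<in>PiE J (\<lambda>_. {..card I}). cell \<tau> \<upsilon> s)" by blast
  qed
  show "finite (\<Union>s\<in>PiE J (\<lambda>_. {..card I}). cell \<tau> \<upsilon> s)"
    by (intro finite_UN_I finite_PiE finJ finite_cell[OF L T g]) auto
qed

lemma pt_of_nat: "pt (\<lambda>i. real (\<mu> i)) \<in> integer_points"
  unfolding pt_def by (intro integer_points_sum integer_points_scale) (use intw in auto)

lemma mass_of_nat:
  assumes "T \<subseteq> I" "\<And>i. i \<notin> T \<Longrightarrow> \<mu> i = 0"
  shows "mass (\<lambda>i. real (\<mu> i)) j = real (sum \<mu> (colour_class T j))"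
  using mass_colour_class[OF assms(1), of "\<lambda>i. real (\<mu> i)"] assms(2) by simp

text \<open>Each coefficient splits uniquely into a fractional and an integral part. Integral parts
  contribute integral masses and a lattice point, so both integrality conditions pass to the
  fractional parts.\<close>

lemma cell_bij:
  assumes T: "\<tau> \<union> \<upsilon> \<subseteq> I" and disj: "\<tau> \<inter> \<upsilon> = {}"
  shows "bij_betw (\<lambda>(b, \<mu>) i. b i + real (\<mu> i))
    (SIGMA b:{b \<in> unit_box \<tau> \<upsilon>. \<forall>j\<in>J. shift b j \<le> m j}. fibre (\<tau> \<union> \<upsilon>) (\<lambda>j. m j - shift b j))
    (cell \<tau> \<upsilon> m)" (is "bij_betw ?f ?S _")
proof (rule bij_betw_imageI)
  show "inj_on ?f ?S"
  proof (rule inj_onI, clarify)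
    fix b \<mu> b' \<mu>'
    assume b: "b \<in> unit_box \<tau> \<upsilon>" "b' \<in> unit_box \<tau> \<upsilon>" and eq: "(\<lambda>i. b i + real (\<mu> i)) = (\<lambda>i. b' i + real (\<mu>' i))"
    have "\<mu> i = \<mu>' i" for i
    proof -
      have e: "b i + real (\<mu> i) = b' i + real (\<mu>' i)" using fun_cong[OF eq, of i] .
      have "\<bar>b i - b' i\<bar> < 1"
      proof -
        consider "i \<in> \<tau>" | "i \<in> \<upsilon>" | "i \<notin> \<tau> \<union> \<upsilon>" by blast
        then have "0 < b i \<and> b i \<le> 1 \<and> 0 < b' i \<and> b' i \<le> 1 \<or> 0 \<le> b i \<and> b i < 1 \<and> 0 \<le> b' i \<and> b' i < 1"
          by cases (use b in \<open>simp_all add: unit_box_def\<close>)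
        then show ?thesis by (auto simp: abs_if)
      qed
      then have "\<bar>real (\<mu>' i) - real (\<mu> i)\<bar> < 1" using e by linarith
      then show ?thesis by linarith
    qed
    moreover from this have "b i = b' i" for i using fun_cong[OF eq, of i] by simp
    ultimately show "b = b' \<and> \<mu> = \<mu>'" by blast
  qed
  show "?f ` ?S = cell \<tau> \<upsilon> m"
  proof (intro equalityI subsetI)
    fix \<theta> assume "\<theta> \<in> ?f ` ?S"
    then obtain b \<mu> where b: "b \<in> unit_box \<tau> \<upsilon>" "\<forall>j\<in>J. shift b j \<le> m j"
      and mu: "\<mu> \<in> fibre (\<tau> \<union> \<upsilon>) (\<lambda>j. m j - shift b j)" and th: "\<theta> = (\<lambda>i. b i + real (\<mu> i))" by auto
    have mu0: "\<mu> i = 0" if "i \<notin> \<tau> \<union> \<upsilon>" for i using mu that by (auto simp: fibre_def)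
    have "mass \<theta> j = real (m j)" if "j \<in> J" for j
    proof -
      have "mass \<theta> j = real (shift b j) + real (m j - shift b j)"
        unfolding th mass_add using mass_of_nat[OF T, of \<mu> j] mu0 mu that unit_box_mass[OF b(1) that]
        by (simp add: fibre_def del: of_nat_sum)
      then show ?thesis using b(2) that by simp
    qed
    moreover have "pt \<theta> \<in> integer_points"
      unfolding th pt_add using b(1) pt_of_nat by (auto intro: integer_points_add simp: unit_box_def)
    ultimately show "\<theta> \<in> cell \<tau> \<upsilon> m"
      using b(1) mu0 by (auto simp: cell_def unit_box_def th add_pos_nonneg)
  next
    fix \<theta> assume th: "\<theta> \<in> cell \<tau> \<upsilon> m"
    \<comment> \<open>Fractional parts in \<open>(0, 1]\<close> call for the ceiling minus 1, those
      in \<open>[0, 1)\<close> for the floor.\<close>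
    define \<mu> where "\<mu> i = (if i \<in> \<tau> then nat (\<lceil>\<theta> i\<rceil> - 1) else if i \<in> \<upsilon> then nat \<lfloor>\<theta> i\<rfloor> else 0)" for i
    define b where "b i = \<theta> i - real (\<mu> i)" for i
    have mu0: "\<mu> i = 0" if "i \<notin> \<tau> \<union> \<upsilon>" for i using that by (simp add: \<mu>_def)
    have tau: "0 < b i \<and> b i \<le> 1" if "i \<in> \<tau>" for i
    proof -
      have "0 < \<theta> i" using th that by (simp add: cell_def)
      then have "\<lceil>\<theta> i\<rceil> \<ge> 1" by linarith
      then have "real (\<mu> i) = of_int \<lceil>\<theta> i\<rceil> - 1" using that by (simp add: \<mu>_def)
      then show ?thesis unfolding b_def by linarith
    qed
    have ups: "0 \<le> b i \<and> b i < 1" if "i \<in> \<upsilon>" for i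
    proof -
      have "0 \<le> \<theta> i" using th that by (simp add: cell_def)
      moreover have "i \<notin> \<tau>" using that disj by auto
      ultimately have "real (\<mu> i) = of_int \<lfloor>\<theta> i\<rfloor>" using that by (simp add: \<mu>_def)
      then show ?thesis unfolding b_def by linarith
    qed
    have massb: "mass b j = real (m j) - real (sum \<mu> (colour_class (\<tau> \<union> \<upsilon>) j))" if "j \<in> J" for j
      unfolding b_def mass_diff using mass_of_nat[OF T mu0] th that by (simp add: cell_def del: of_nat_sum)
    have "pt b \<in> integer_points"
      unfolding b_def pt_diff using pt_of_nat th by (auto intro: integer_points_diff simp: cell_def)
    moreover have "b i = 0" if "i \<notin> \<tau> \<union> \<upsilon>" for i using th that mu0[OF that] by (simp add: b_def cell_def)
    ultimately have b: "b \<in> unit_box \<tau> \<upsilon>" using tau ups massb by (simp add: unit_box_def del: of_nat_sum)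
    have "shift b j \<le> m j \<and> sum \<mu> (colour_class (\<tau> \<union> \<upsilon>) j) = m j - shift b j" if "j \<in> J" for j
      using massb[OF that] unit_box_mass[OF b that] by linarith
    then have "(b, \<mu>) \<in> ?S" using b mu0 by (auto simp: fibre_def)
    moreover have "\<theta> = ?f (b, \<mu>)" by (simp add: b_def)
    ultimately show "\<theta> \<in> ?f ` ?S" by blast
  qed
qed

lemma card_cell:
  assumes L: "0 \<notin> snd ` set L" "fst ` set L = I" and T: "\<tau> \<union> \<upsilon> \<subseteq> I" and disj: "\<tau> \<inter> \<upsilon> = {}"
    and g: "good L (\<tau> \<union> \<upsilon>)"
  shows "card (cell \<tau> \<upsilon> m) =
    (\<Sum>b\<in>unit_box \<tau> \<upsilon>. \<Prod>j\<in>J. shifted_wcount (card (colour_class (\<tau> \<union> \<upsilon>) j)) (shift b j) (m j))"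
proof -
  let ?B = "{b \<in> unit_box \<tau> \<upsilon>. \<forall>j\<in>J. shift b j \<le> m j}"
  let ?w = "\<lambda>b. \<Prod>j\<in>J. shifted_wcount (card (colour_class (\<tau> \<union> \<upsilon>) j)) (shift b j) (m j)"
  have fin: "finite (unit_box \<tau> \<upsilon>)" by (rule finite_unit_box[OF L T g])
  have "card (cell \<tau> \<upsilon> m) = (\<Sum>b\<in>?B. card (fibre (\<tau> \<union> \<upsilon>) (\<lambda>j. m j - shift b j)))"
    unfolding bij_betw_same_card[OF cell_bij[OF T disj, of m], symmetric]
    by (rule card_SigmaI) (use fin finite_fibre[OF T] in auto)
  also have "\<dots> = (\<Sum>b\<in>?B. ?w b)"
    unfolding card_fibre[OF T] by (intro sum.cong prod.cong) (auto simp: shifted_wcount_def)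
  \<comment> \<open>Box points with too large a shift in some colour may be added, as
    \<open>shifted_wcount\<close> vanishes there.\<close>
  also have "\<dots> = (\<Sum>b\<in>unit_box \<tau> \<upsilon>. ?w b)"
  proof (rule sum.mono_neutral_left[OF fin])
    show "\<forall>b\<in>unit_box \<tau> \<upsilon> - ?B. ?w b = 0"
    proof
      fix b assume "b \<in> unit_box \<tau> \<upsilon> - ?B"
      then obtain j where "j \<in> J" "\<not> shift b j \<le> m j" by auto
      then show "?w b = 0" by (intro prod_zero[OF finJ]) (auto simp: shifted_wcount_def)
    qed
  qed auto
  finally show ?thesis .
qed

section \<open>Polynomiality for positive masses and in a single coordinate\<close>

definition cell_poly :: "'i set \<Rightarrow> ('i \<Rightarrow> real) \<Rightarrow> 'c \<Rightarrow> real poly" where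
  "cell_poly \<sigma> b j = binom_poly (card (colour_class \<sigma> j) - 1) (shift b j)"

text \<open>A shift is at most the number \<open>t\<close> of points of its colour, and
  \<open>t \<le> m j + (t - 1)\<close> as soon as \<open>m j\<close> is positive. A cell that misses
  a colour is empty, because it gives that colour mass 0.\<close>

lemma card_open_cell:
  assumes L: "0 \<notin> snd ` set L" "fst ` set L = I" and s: "\<sigma> \<subseteq> I" and g: "good L \<sigma>"
    and m: "\<And>j. j \<in> J \<Longrightarrow> m j \<ge> 1"
  shows "real (card (cell \<sigma> {} m)) =
    (if J \<subseteq> col ` \<sigma> then (\<Sum>b\<in>unit_box \<sigma> {}. \<Prod>j\<in>J. poly (cell_poly \<sigma> b j) (real (m j))) else 0)"
proof (cases "J \<subseteq> col ` \<sigma>")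
  case True
  have "real (shifted_wcount (card (colour_class \<sigma> j)) (shift b j) (m j)) = poly (cell_poly \<sigma> b j) (real (m j))"
    if b: "b \<in> unit_box \<sigma> {}" and j: "j \<in> J" for b j
    unfolding cell_poly_def
  proof (rule shifted_wcount_eq_poly)
    have "colour_class \<sigma> j \<noteq> {}" using True j by (auto simp: colour_class_def)
    then show t: "card (colour_class \<sigma> j) \<ge> 1"
      using finite_colour_class[OF s, of j] by (simp add: Suc_le_eq card_gt_0_iff)
    show "shift b j \<le> m j + (card (colour_class \<sigma> j) - 1)"
      using shift_le[OF b j] s m[OF j] t by simp
  qed
  then show ?thesis using True s g disjoint_iff
    by (subst card_cell[OF L]) (auto intro!: sum.cong prod.cong)
next
  case False
  then obtain j where j: "j \<in> J" "j \<notin> col ` \<sigma>" by auto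
  have "\<theta> \<notin> cell \<sigma> {} m" for \<theta>
  proof
    assume t: "\<theta> \<in> cell \<sigma> {} m"
    have "mass \<theta> j = sum \<theta> (colour_class \<sigma> j)"
      by (rule mass_colour_class[OF s]) (use t in \<open>auto simp: cell_def\<close>)
    also have "colour_class \<sigma> j = {}" using j by (auto simp: colour_class_def)
    finally show False using t j m[of j] by (simp add: cell_def)
  qed
  then have "cell \<sigma> {} m = {}" by blast
  then show ?thesis using False by simp
qed

lemma card_pts_eq_poly_pos:
  assumes L: "0 \<notin> snd ` set L" "fst ` set L = I" and m: "\<And>j. j \<in> J \<Longrightarrow> m j \<ge> 1"
  shows "real (card (pts m)) = (\<Sum>\<sigma> | \<sigma> \<subseteq> I \<and> good L \<sigma> \<and> J \<subseteq> col ` \<sigma>.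
    \<Sum>b\<in>unit_box \<sigma> {}. \<Prod>j\<in>J. poly (cell_poly \<sigma> b j) (real (m j)))"
proof -
  have "real (card (pts m)) = (\<Sum>\<sigma> | \<sigma> \<subseteq> I \<and> good L \<sigma>. real (card (cell \<sigma> {} m)))"
    by (simp add: card_pts_eq_sum_cells[OF L])
  also have "\<dots> = (\<Sum>\<sigma> | \<sigma> \<subseteq> I \<and> good L \<sigma>. if J \<subseteq> col ` \<sigma>
      then (\<Sum>b\<in>unit_box \<sigma> {}. \<Prod>j\<in>J. poly (cell_poly \<sigma> b j) (real (m j))) else 0)"
    by (intro sum.cong refl card_open_cell[OF L] m) auto
  also have "\<dots> = (\<Sum>\<sigma> | \<sigma> \<subseteq> I \<and> good L \<sigma> \<and> J \<subseteq> col ` \<sigma>.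
      \<Sum>b\<in>unit_box \<sigma> {}. \<Prod>j\<in>J. poly (cell_poly \<sigma> b j) (real (m j)))"
    by (rule sum.mono_neutral_cong_right) (use finI in auto)
  finally show ?thesis .
qed

text \<open>
  When the coordinate of \<open>v\<close> is maximised first, every good set stays good after \<open>v\<close> is added,
  and the half-open cells are counted by a polynomial for all arguments, \<open>0\<close> included.
\<close>

lemma card_pts_poly_in_coordinate:
  assumes c: "c \<in> col ` I"
  shows "\<exists>q. \<forall>n. poly q (real n) = real (card (pts (m(c := n))))"
proof -
  obtain v where v: "v \<in> I" "col v = c" using c by auto
  \<comment> \<open>The weight \<open>- 1\<close> and the first place in \<open>L\<close>, defined
    below, make \<open>v\<close> the coordinate that is maximised first.\<close>
  then have cJ: "c \<in> J" using colI by auto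
  obtain xs where xs: "set xs = I - {v}" using finite_list[of "I - {v}"] finI by auto
  define L where "L = (v, - 1 :: real) # map (\<lambda>i. (i, 1)) xs"
  have "fst ` set L = insert v (set xs)" by (simp add: L_def image_image)
  then have L2: "fst ` set L = I" using v(1) by (simp only: xs insert_Diff)
  have L1: "0 \<notin> snd ` set L" by (auto simp: L_def)
  note L = L1 L2
  have cone: "good L (insert v \<sigma>)" if s: "good L \<sigma>" for \<sigma>
    unfolding good_def
  proof (intro ballI impI)
    fix \<delta> assume d: "\<delta> \<in> ker" "lexneg L \<delta>"
    then obtain i where "i \<in> I - \<sigma>" "\<delta> i < 0" using s by (auto simp: good_def)
    \<comment> \<open>An improving direction cannot decrease the coordinate of \<open>v\<close>, so
      the index \<open>i\<close> found differs from \<open>v\<close>.\<close>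
    moreover have "\<delta> v \<ge> 0" using d(2) by (auto simp: L_def)
    ultimately show "\<exists>i\<in>I - insert v \<sigma>. \<delta> i < 0" by (intro bexI[of _ i]) auto
  qed
  let ?S = "{\<sigma>. \<sigma> \<subseteq> I \<and> good L \<sigma> \<and> v \<notin> \<sigma>}"
  \<comment> \<open>Only colour \<open>c\<close> is made polynomial; the other colours keep their
    exact counts, as \<open>m\<close> may vanish on them.\<close>
  define q where "q = (\<Sum>\<sigma>\<in>?S. \<Sum>b\<in>unit_box \<sigma> {v}.
      smult (\<Prod>j\<in>J - {c}. real (shifted_wcount (card (colour_class (\<sigma> \<union> {v}) j)) (shift b j) (m j)))
        (cell_poly (\<sigma> \<union> {v}) b c))"
  have "poly q (real n) = real (card (pts (m(c := n))))" for n
  proof -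
    have cc: "real (shifted_wcount (card (colour_class (\<sigma> \<union> {v}) c)) (shift b c) n) =
        poly (cell_poly (\<sigma> \<union> {v}) b c) (real n)"
      if s: "\<sigma> \<in> ?S" and b: "b \<in> unit_box \<sigma> {v}" for \<sigma> b
    proof -
      have T: "\<sigma> \<union> {v} \<subseteq> I" using s v by auto
      have less: "shift b c < card (colour_class (\<sigma> \<union> {v}) c)"
        using shift_less[OF b cJ T] v by auto
      show ?thesis unfolding cell_poly_def by (rule shifted_wcount_eq_poly) (use less in linarith)+
    qed
    have "card (pts (m(c := n))) = (\<Sum>\<sigma>\<in>?S. card (cell \<sigma> {v} (m(c := n))))"
      by (rule card_pts_eq_sum_half_open[OF L v(1)]) (use cone in blast)
    also have "\<dots> = (\<Sum>\<sigma>\<in>?S. \<Sum>b\<in>unit_box \<sigma> {v}. \<Prod>j\<in>J.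
        shifted_wcount (card (colour_class (\<sigma> \<union> {v}) j)) (shift b j) ((m(c := n)) j))"
      by (intro sum.cong refl card_cell[OF L]) (use v cone in auto)
    also have "\<dots> = (\<Sum>\<sigma>\<in>?S. \<Sum>b\<in>unit_box \<sigma> {v}.
        shifted_wcount (card (colour_class (\<sigma> \<union> {v}) c)) (shift b c) n *
        (\<Prod>j\<in>J - {c}. shifted_wcount (card (colour_class (\<sigma> \<union> {v}) j)) (shift b j) (m j)))"
      by (intro sum.cong refl, subst prod.remove[OF finJ cJ]) (auto intro!: prod.cong)
    finally have "real (card (pts (m(c := n)))) = (\<Sum>\<sigma>\<in>?S. \<Sum>b\<in>unit_box \<sigma> {v}.
        real (shifted_wcount (card (colour_class (\<sigma> \<union> {v}) c)) (shift b c) n) *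
        (\<Prod>j\<in>J - {c}. real (shifted_wcount (card (colour_class (\<sigma> \<union> {v}) j)) (shift b j) (m j))))"
      by (simp only: of_nat_sum of_nat_mult of_nat_prod)
    also have "\<dots> = poly q (real n)"
      unfolding q_def poly_sum poly_smult
      by (intro sum.cong refl) (simp only: cc mult.commute)
    finally show ?thesis ..
  qed
  then show ?thesis by blast
qed

end

section \<open>The counting function is polynomial\<close>

lemma poly_eq_if_eq_on_large_nats:
  fixes p q :: "real poly"
  assumes "\<And>n::nat. n \<ge> N \<Longrightarrow> poly p (real n) = poly q (real n)"
  shows "p = q"
proof (rule ccontr)
  assume "p \<noteq> q"
  then have "finite {x. poly (p - q) x = 0}" by (intro poly_roots_finite) simp
  moreover have "real ` {N..} \<subseteq> {x. poly (p - q) x = 0}" using assms by auto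
  ultimately have "finite (real ` {N..})" by (rule rev_finite_subset)
  then show False by (simp add: finite_image_iff infinite_Ici)
qed

lemma lexneg_zero: "\<not> lexneg L (\<lambda>_. 0)"
  by (induction L) (auto split: prod.splits)

lemma lexneg_append_nonneg:
  "lexneg (map (\<lambda>i. (i, 1)) (xs @ ys)) \<delta> \<Longrightarrow> \<forall>i\<in>set xs. 0 \<le> \<delta> i \<Longrightarrow> \<forall>i\<in>set xs. \<delta> i = 0"
  by (induction xs) auto

context coloured_points
begin

text \<open>Induction on the number of colours with mass 0. As a function of one such mass, both
  sides are polynomials; they agree on positive arguments by induction and hence at 0. The
  polynomial for the left side may come from another order of the coordinates, since the count does
  not depend on the order.\<close>

theorem card_pts_eq_poly:
  assumes L: "0 \<notin> snd ` set L" "fst ` set L = I" and J: "col ` I = J"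
  shows "real (card (pts m)) = (\<Sum>\<sigma> | \<sigma> \<subseteq> I \<and> good L \<sigma> \<and> J \<subseteq> col ` \<sigma>.
    \<Sum>b\<in>unit_box \<sigma> {}. \<Prod>j\<in>J. poly (cell_poly \<sigma> b j) (real (m j)))"
proof (induction "card {j \<in> J. m j = 0}" arbitrary: m rule: less_induct)
  case less
  let ?S = "{\<sigma>. \<sigma> \<subseteq> I \<and> good L \<sigma> \<and> J \<subseteq> col ` \<sigma>}"
  let ?P = "\<lambda>m. \<Sum>\<sigma>\<in>?S. \<Sum>b\<in>unit_box \<sigma> {}. \<Prod>j\<in>J. poly (cell_poly \<sigma> b j) (real (m j))"
  show ?case
  proof (cases "\<exists>c\<in>J. m c = 0")
    case False
    then show ?thesis by (intro card_pts_eq_poly_pos[OF L]) (metis One_nat_def Suc_leI neq0_conv)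
  next
    case True
    then obtain c where c: "c \<in> J" "m c = 0" by blast
    obtain q where q: "\<And>n. poly q (real n) = real (card (pts (m(c := n))))"
      using card_pts_poly_in_coordinate c(1) J by metis
    define p where "p = (\<Sum>\<sigma>\<in>?S. \<Sum>b\<in>unit_box \<sigma> {}.
      smult (\<Prod>j\<in>J - {c}. poly (cell_poly \<sigma> b j) (real (m j))) (cell_poly \<sigma> b c))"
    have "?P (m(c := n)) = (\<Sum>\<sigma>\<in>?S. \<Sum>b\<in>unit_box \<sigma> {}. poly (cell_poly \<sigma> b c) (real n) *
        (\<Prod>j\<in>J - {c}. poly (cell_poly \<sigma> b j) (real (m j))))" for n
      by (intro sum.cong refl, subst prod.remove[OF finJ c(1)]) (auto intro!: prod.cong)
    then have p: "poly p (real n) = ?P (m(c := n))" for n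
      unfolding p_def poly_sum poly_smult by (simp add: mult.commute)
    have "poly q (real n) = poly p (real n)" if n: "n \<ge> 1" for n
    proof -
      have "{j \<in> J. (m(c := n)) j = 0} \<subset> {j \<in> J. m j = 0}" using c n by auto
      then have "card {j \<in> J. (m(c := n)) j = 0} < card {j \<in> J. m j = 0}"
        by (intro psubset_card_mono) (use finJ in auto)
      from less[OF this] show ?thesis by (simp only: p q)
    qed
    then have "q = p" by (rule poly_eq_if_eq_on_large_nats)
    moreover have "m(c := 0) = m" using c(2) by auto
    ultimately show ?thesis using p[of 0] q[of 0] by simp
  qed
qed

text \<open>The coloured analogue of affine independence for the points of \<open>\<sigma>\<close>.\<close>

definition coloured_independent :: "'i set \<Rightarrow> bool" where
  "coloured_independent \<sigma> \<longleftrightarrow> (\<forall>\<delta>\<in>ker. (\<forall>i. i \<notin> \<sigma> \<longrightarrow> \<delta> i = 0) \<longrightarrow> \<delta> = (\<lambda>_. 0))"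

text \<open>Of a nonzero direction in \<open>ker\<close> and its negative one improves the order,
  but neither has a negative coordinate off \<open>\<sigma>\<close> if both are supported in
  \<open>\<sigma>\<close>.\<close>

lemma good_imp_coloured_independent:
  assumes L: "0 \<notin> snd ` set L" "fst ` set L = I" and g: "good L \<sigma>"
  shows "coloured_independent \<sigma>"
  unfolding coloured_independent_def
proof (intro ballI impI, rule ccontr)
  fix \<delta> assume d: "\<delta> \<in> ker" "\<forall>i. i \<notin> \<sigma> \<longrightarrow> \<delta> i = 0" "\<delta> \<noteq> (\<lambda>_. 0)"
  from d(3) obtain i where i: "\<delta> i \<noteq> 0" by auto
  then have "i \<in> fst ` set L" using d(1) L(2) by (auto simp: ker_def)
  with lexneg_total[of L i \<delta>] L(1) i have "lexneg L \<delta> \<or> lexneg L (\<lambda>i. - \<delta> i)" by blast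
  moreover have "(\<lambda>i. - \<delta> i) \<in> ker"
    using d(1) mass_scale[of "-1" \<delta>] pt_scale[of "-1" \<delta>] by (simp add: ker_def)
  ultimately show False using g d(1,2) by (fastforce simp: good_def)
qed

text \<open>Minimise the coordinates outside \<open>\<sigma>\<close> first. An improving direction
  that is nonnegative there must vanish there, and independence makes it zero.\<close>

lemma good_if_coloured_independent:
  assumes s: "\<sigma> \<subseteq> I" and ind: "coloured_independent \<sigma>"
  shows "\<exists>L. 0 \<notin> snd ` set L \<and> fst ` set L = I \<and> good L \<sigma>"
proof -
  obtain xs where xs: "set xs = I - \<sigma>" using finite_list[of "I - \<sigma>"] finI by auto
  obtain ys where ys: "set ys = \<sigma>" using finite_list[OF finite_subset[OF s finI]] by auto
  define L where "L = map (\<lambda>i. (i, 1 :: real)) (xs @ ys)"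
  have "good L \<sigma>"
    unfolding good_def
  proof (intro ballI impI, rule ccontr)
    fix \<delta> assume d: "\<delta> \<in> ker" "lexneg L \<delta>" "\<not> (\<exists>i\<in>I - \<sigma>. \<delta> i < 0)"
    then have "\<forall>i\<in>set xs. \<delta> i = 0"
      by (intro lexneg_append_nonneg[of xs ys]) (auto simp: L_def xs not_less)
    moreover have "\<delta> i = 0" if "i \<notin> I" for i using d(1) that by (simp add: ker_def)
    ultimately have "\<forall>i. i \<notin> \<sigma> \<longrightarrow> \<delta> i = 0" using xs by blast
    then have "\<delta> = (\<lambda>_. 0)"
      using ind d(1) unfolding coloured_independent_def by blast
    then show False using d(2) by (simp add: lexneg_zero)
  qed
  moreover have "fst ` set L = I" using s by (auto simp: L_def xs ys image_Un image_image)
  moreover have "0 \<notin> snd ` set L" by (auto simp: L_def)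
  ultimately show ?thesis by blast
qed

end

section \<open>Cells that meet every colour twice\<close>

lemma sum_scaleR_inj_on:
  assumes "inj_on u T"
  shows "(\<Sum>x\<in>u ` T. f x *\<^sub>R x) = (\<Sum>i\<in>T. f (u i) *\<^sub>R u i)"
  by (simp add: sum.reindex[OF assms] o_def)

lemma card_independent_family_le:
  fixes u :: "'i \<Rightarrow> real ^ 'd"
  assumes fin: "finite T" and ind: "\<And>c. (\<Sum>i\<in>T. c i *\<^sub>R u i) = 0 \<Longrightarrow> \<forall>i\<in>T. c i = 0"
  shows "card T \<le> CARD('d)"
proof -
  have inj: "inj_on u T"
  proof (rule inj_onI, rule ccontr)
    fix i j assume ij: "i \<in> T" "j \<in> T" "u i = u j" "i \<noteq> j"
    define c where "c = (\<lambda>x. if x = i then 1 else if x = j then - 1 else (0::real))"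
    have "(\<Sum>x\<in>T. c x *\<^sub>R u x) = (\<Sum>x\<in>{i, j}. c x *\<^sub>R u x)"
      by (rule sum.mono_neutral_right[OF fin]) (use ij in \<open>auto simp: c_def\<close>)
    also have "\<dots> = 0" using ij by (simp add: c_def)
    finally show False using ind[of c] ij(1) by (auto simp: c_def)
  qed
  have "independent (u ` T)"
    unfolding dependent_finite[OF finite_imageI[OF fin]]
  proof clarify
    fix f i assume "(\<Sum>x\<in>u ` T. f x *\<^sub>R x) = 0" "i \<in> T" "f (u i) \<noteq> 0"
    then show False using ind[of "\<lambda>i. f (u i)"] by (simp add: sum_scaleR_inj_on[OF inj])
  qed
  then have "card (u ` T) \<le> DIM(real ^ 'd)" by (rule independent_card_le)
  then show ?thesis by (simp add: card_image[OF inj])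
qed

context coloured_points
begin

text \<open>The function \<open>r\<close> picks a base point in every colour; edges start at the
  base point of their own colour.\<close>

definition edge :: "('c \<Rightarrow> 'i) \<Rightarrow> 'i \<Rightarrow> real ^ 'd" where
  "edge r i = w i - w (r (col i))"

text \<open>On \<open>ker\<close> the second sum vanishes, which turns coloured independence into
  linear independence of edges.\<close>

lemma pt_eq_sum_edges:
  "pt \<delta> = (\<Sum>i\<in>I. \<delta> i *\<^sub>R edge r i) + (\<Sum>j\<in>J. mass \<delta> j *\<^sub>R w (r j))"
proof -
  have "(\<Sum>j\<in>J. mass \<delta> j *\<^sub>R w (r j)) = (\<Sum>j\<in>J. \<Sum>i | i \<in> I \<and> col i = j. \<delta> i *\<^sub>R w (r (col i)))"
    by (intro sum.cong) (auto simp: mass_def scaleR_sum_left intro!: sum.cong)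
  also have "\<dots> = (\<Sum>i\<in>I. \<delta> i *\<^sub>R w (r (col i)))"
    by (rule sum.group[OF finI finJ colI])
  finally show ?thesis
    by (simp add: pt_def edge_def scaleR_diff_right sum_subtractf)
qed

lemma card_eq_sum_colour_classes:
  assumes "T \<subseteq> I"
  shows "card T = (\<Sum>j\<in>J. card (colour_class T j))"
proof -
  have "(\<Sum>j\<in>J. sum (\<lambda>_. 1::nat) {i \<in> T. col i = j}) = sum (\<lambda>_. 1::nat) T"
    by (rule sum.group) (use assms finI finJ colI in \<open>auto intro: finite_subset\<close>)
  then show ?thesis by (simp add: colour_class_def)
qed

text \<open>Without one base point per colour, the remaining points give linearly independent edges,
  and there are \<open>card (colour_class \<sigma> j) - 1\<close> of them in colour
  \<open>j\<close>.\<close>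

lemma coloured_independent_card_le:
  assumes s: "\<sigma> \<subseteq> I" and J: "J \<subseteq> col ` \<sigma>" and ind: "coloured_independent \<sigma>"
  shows "(\<Sum>j\<in>J. card (colour_class \<sigma> j) - 1) \<le> CARD('d)"
proof -
  have "\<forall>j\<in>J. \<exists>i\<in>\<sigma>. col i = j" using J by auto
  then obtain r where r: "\<And>j. j \<in> J \<Longrightarrow> r j \<in> \<sigma> \<and> col (r j) = j" by metis
  define T where "T = \<sigma> - r ` J"
  have T: "T \<subseteq> I" "finite T" using s finI by (auto simp: T_def intro: finite_subset)
  have edge_r: "edge r (r j) = 0" if "j \<in> J" for j using r[OF that] by (simp add: edge_def)
  have cls: "colour_class \<sigma> j = insert (r j) (colour_class T j)" "r j \<notin> colour_class T j" if "j \<in> J" for j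
    using r that by (auto simp: colour_class_def T_def)
  have "(\<Sum>j\<in>J. card (colour_class \<sigma> j) - 1) = (\<Sum>j\<in>J. card (colour_class T j))"
    using cls finite_colour_class[OF T(1)] by (intro sum.cong) auto
  also have "\<dots> = card T" using card_eq_sum_colour_classes[OF T(1)] by simp
  also have "\<dots> \<le> CARD('d)"
  proof (rule card_independent_family_le[OF T(2)])
    fix c assume c: "(\<Sum>i\<in>T. c i *\<^sub>R edge r i) = 0"
    \<comment> \<open>The value at a base point cancels the mass of its colour, so the linear
      relation extends to an element of \<open>ker\<close>.\<close>
    define \<delta> where "\<delta> i = (if i \<in> T then c i else if i \<in> r ` J then - sum c (colour_class T (col i)) else 0)" for i
    have sup: "\<delta> i = 0" if "i \<notin> \<sigma>" for i using that r by (auto simp: \<delta>_def T_def)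
    have "mass \<delta> j = 0" if j: "j \<in> J" for j
    proof -
      have "mass \<delta> j = sum \<delta> (colour_class \<sigma> j)" by (rule mass_colour_class[OF s sup])
      also have "\<dots> = \<delta> (r j) + sum \<delta> (colour_class T j)"
        using cls[OF j] finite_colour_class[OF T(1)] by simp
      also have "sum \<delta> (colour_class T j) = sum c (colour_class T j)"
        by (rule sum.cong) (auto simp: \<delta>_def colour_class_def)
      also have "\<delta> (r j) = - sum c (colour_class T j)" using j r[OF j] by (simp add: \<delta>_def T_def)
      finally show ?thesis by simp
    qed
    moreover have "(\<Sum>i\<in>I. \<delta> i *\<^sub>R edge r i) = (\<Sum>i\<in>T. c i *\<^sub>R edge r i)"
      by (rule sum.mono_neutral_cong_right) (use finI T edge_r in \<open>auto simp: \<delta>_def\<close>)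
    ultimately have "pt \<delta> = 0" using c by (simp add: pt_eq_sum_edges[of _ r])
    then have "\<delta> \<in> ker" using \<open>\<And>j. j \<in> J \<Longrightarrow> mass \<delta> j = 0\<close> sup s by (auto simp: ker_def)
    then have "\<delta> = (\<lambda>_. 0)" using ind sup by (auto simp: coloured_independent_def)
    then show "\<forall>i\<in>T. c i = 0" by (metis \<delta>_def)
  qed
  finally show ?thesis .
qed

text \<open>An element of \<open>ker\<close> is a linear relation between the edges, so it vanishes
  on \<open>T\<close>; zero mass then forces it to vanish at the base points.\<close>

lemma coloured_independent_if_edges_independent:
  assumes T: "T \<subseteq> I" and r: "\<And>j. j \<in> J \<Longrightarrow> r j \<in> I \<and> col (r j) = j" and disj: "T \<inter> r ` J = {}"
    and inj: "inj_on (edge r) T" and ind: "independent (edge r ` T)"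
  shows "coloured_independent (T \<union> r ` J)"
  unfolding coloured_independent_def
proof (intro ballI impI)
  have fin: "finite T" using T finI finite_subset by blast
  fix \<delta> assume d: "\<delta> \<in> ker" "\<forall>i. i \<notin> T \<union> r ` J \<longrightarrow> \<delta> i = 0"
  have edge_r: "edge r (r j) = 0" if "j \<in> J" for j using r[OF that] by (simp add: edge_def)
  have "\<And>j. j \<in> J \<Longrightarrow> mass \<delta> j = 0" "0 = pt \<delta>" using d(1) by (simp_all add: ker_def)
  then have "0 = (\<Sum>i\<in>I. \<delta> i *\<^sub>R edge r i)"
    by (simp add: pt_eq_sum_edges[of _ r])
  also have "\<dots> = (\<Sum>i\<in>T. \<delta> i *\<^sub>R edge r i)"
    by (rule sum.mono_neutral_right) (use finI T d(2) edge_r in auto)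
  also have "\<dots> = (\<Sum>x\<in>edge r ` T. \<delta> (the_inv_into T (edge r) x) *\<^sub>R x)"
    by (simp add: sum_scaleR_inj_on[OF inj] the_inv_into_f_f[OF inj])
  finally have z: "(\<Sum>x\<in>edge r ` T. \<delta> (the_inv_into T (edge r) x) *\<^sub>R x) = 0" by simp
  have dT: "\<delta> i = 0" if "i \<in> T" for i
    using independentD[OF ind finite_imageI[OF fin] subset_refl z, of "edge r i"] that
    by (simp add: the_inv_into_f_f[OF inj])
  have "\<delta> (r j) = 0" if j: "j \<in> J" for j
  proof -
    have "mass \<delta> j = sum \<delta> (colour_class (T \<union> r ` J) j)"
      by (rule mass_colour_class) (use T r d(2) in auto)
    also have "\<dots> = sum \<delta> {r j}"
      by (rule sum.mono_neutral_right)
        (use T r d(2) j dT in \<open>auto simp: colour_class_def intro!: finite_subset[OF _ finI]\<close>)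
    finally show ?thesis using d(1) j by (simp add: ker_def)
  qed
  with dT d(2) show "\<delta> = (\<lambda>_. 0)" by fast
qed

text \<open>As each colour class spans, one edge per colour can be chosen greedily with all choices
  independent. Extending them by further edges to a basis and adding the base points gives at least
  two points of every colour.\<close>

lemma exists_mixed_coloured_independent:
  assumes r: "\<And>j. j \<in> J \<Longrightarrow> r j \<in> I \<and> col (r j) = j"
    and span: "\<And>j. j \<in> J \<Longrightarrow> span (edge r ` colour_class I j) = UNIV"
    and J: "card J \<le> CARD('d)" "J \<noteq> {}"
  shows "\<exists>\<sigma>\<subseteq>I. coloured_independent \<sigma> \<and> (\<forall>j\<in>J. card (colour_class \<sigma> j) \<ge> 2) \<and>
    (\<Sum>j\<in>J. card (colour_class \<sigma> j) - 1) = CARD('d)"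
proof -
  let ?u = "edge r"
  have "\<exists>g. (\<forall>j\<in>K. g j \<in> colour_class I j) \<and> inj_on (?u \<circ> g) K \<and> independent ((?u \<circ> g) ` K)"
    if "finite K" "K \<subseteq> J" "card K \<le> CARD('d)" for K
    using that
  proof (induction K rule: finite_induct)
    case empty
    then show ?case by (auto simp: independent_empty)
  next
    case (insert j K)
    then have "K \<subseteq> J" "card K \<le> CARD('d)" by auto
    with insert.IH obtain g where g: "\<And>j. j \<in> K \<Longrightarrow> g j \<in> colour_class I j"
      "inj_on (?u \<circ> g) K" "independent ((?u \<circ> g) ` K)" by blast
    let ?B = "(?u \<circ> g) ` K"
    \<comment> \<open>Fewer than \<open>CARD('d)\<close> edges have been chosen so far, so they do
      not span, whereas those of colour \<open>j\<close> do.\<close>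
    have "\<exists>i\<in>colour_class I j. ?u i \<notin> span ?B"
    proof (rule ccontr)
      assume "\<not> ?thesis"
      then have "?u ` colour_class I j \<subseteq> span ?B" by auto
      then have "span (?u ` colour_class I j) \<subseteq> span ?B" by (rule span_minimal) simp
      then have "span ?B = UNIV" using span insert.prems by auto
      then have "DIM(real ^ 'd) \<le> card ?B"
        using dim_le_card'[of ?B] dim_UNIV insert.hyps dim_span[of ?B] by (metis finite_imageI)
      also have "\<dots> \<le> card K" using insert.hyps by (simp add: card_image_le)
      finally show False using insert by simp
    qed
    then obtain i where i: "i \<in> colour_class I j" "?u i \<notin> span ?B" by blast
    let ?g = "g(j := i)"
    have im: "(?u \<circ> ?g) ` insert j K = insert (?u i) ?B" using insert.hyps by auto
    have "inj_on (?u \<circ> ?g) K" using g(2) insert.hyps by (auto simp: inj_on_def)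
    moreover have "(?u \<circ> ?g) ` K = ?B" using insert.hyps by auto
    moreover have "?u i \<notin> ?B" using i(2) span_base by metis
    ultimately have "inj_on (?u \<circ> ?g) (insert j K)"
      using insert.hyps by (simp add: inj_on_insert)
    moreover have "independent ((?u \<circ> ?g) ` insert j K)"
      unfolding im using i(2) g(3) by (rule independent_insertI)
    moreover have "\<forall>k\<in>insert j K. ?g k \<in> colour_class I k" using g(1) i(1) insert.hyps by auto
    ultimately show ?case by blast
  qed
  from this[OF finJ subset_refl J(1)] obtain g where
    g: "\<And>j. j \<in> J \<Longrightarrow> g j \<in> colour_class I j" "inj_on (?u \<circ> g) J" "independent ((?u \<circ> g) ` J)" by blast
  let ?B = "(?u \<circ> g) ` J"
  have "?B \<subseteq> ?u ` I" using g(1) by (auto simp: colour_class_def)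
  then obtain C where C: "?B \<subseteq> C" "C \<subseteq> ?u ` I" "independent C" "?u ` I \<subseteq> span C"
    using maximal_independent_subset_extend[OF _ g(3)] by blast
  have "span C = UNIV"
  proof -
    obtain j where j: "j \<in> J" using J(2) by blast
    have "?u ` colour_class I j \<subseteq> span C" using C(4) by (auto simp: colour_class_def)
    then have "span (?u ` colour_class I j) \<subseteq> span C" by (rule span_minimal) simp
    then show ?thesis using span[OF j] by auto
  qed
  then have cardC: "card C = CARD('d)"
    using dim_eq_card_independent[OF C(3)] dim_span[of C] dim_UNIV[where 'a = "real ^ 'd"] by simp
  have "\<forall>x\<in>C - ?B. \<exists>i\<in>I. ?u i = x" using C(2) by auto
  then obtain h where h: "\<And>x. x \<in> C - ?B \<Longrightarrow> h x \<in> I \<and> ?u (h x) = x" by metis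
  define T where "T = g ` J \<union> h ` (C - ?B)"
  have TI: "T \<subseteq> I" using g(1) h by (auto simp: T_def colour_class_def)
  have uT: "?u ` T = C"
    using C(1) h by (force simp: T_def image_Un image_image)
  have "finite C" using C(2) finI finite_subset by blast
  then have finT: "finite T" using finJ by (simp add: T_def)
  \<comment> \<open>\<open>T\<close> has at most as many elements as its image \<open>C\<close>,
    which forces the edge map to be injective on \<open>T\<close>.\<close>
  have "card T \<le> card (g ` J) + card (h ` (C - ?B))" unfolding T_def by (rule card_Un_le)
  also have "\<dots> \<le> card J + card (C - ?B)"
    by (intro add_mono card_image_le) (use finJ \<open>finite C\<close> in auto)
  also have "\<dots> = card ?B + card (C - ?B)" by (simp only: card_image[OF g(2)])
  also have "\<dots> = card C" using card_Diff_subset[of ?B C] card_mono[of C ?B] C(1) \<open>finite C\<close> finJ by simp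
  finally have "card T \<le> card (?u ` T)" using uT by simp
  then have cardT: "card T = card C" and inj: "inj_on ?u T"
    using card_image_le[OF finT, of ?u] uT eq_card_imp_inj_on[OF finT, of ?u] by auto
  have edge_r: "?u (r j) = 0" if "j \<in> J" for j using r[OF that] by (simp add: edge_def)
  have disj: "T \<inter> r ` J = {}"
  proof (rule ccontr)
    assume "T \<inter> r ` J \<noteq> {}"
    then have "0 \<in> C" using uT edge_r by force
    then show False using C(3) dependent_zero by blast
  qed
  let ?s = "T \<union> r ` J"
  have ci: "coloured_independent ?s"
    by (rule coloured_independent_if_edges_independent[OF TI r disj inj]) (use C(3) uT in auto)
  have cls: "card (colour_class ?s j) = Suc (card (colour_class T j))" if j: "j \<in> J" for j
  proof -
    have "colour_class ?s j = insert (r j) (colour_class T j)" "r j \<notin> colour_class T j"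
      using r j disj by (auto simp: colour_class_def)
    then show ?thesis using finite_colour_class[OF TI] by simp
  qed
  have "card (colour_class ?s j) \<ge> 2" if j: "j \<in> J" for j
  proof -
    have "g j \<in> colour_class T j" using g(1)[OF j] j by (auto simp: colour_class_def T_def)
    then have "card (colour_class T j) > 0"
      using finite_colour_class[OF TI] card_gt_0_iff by blast
    then show ?thesis using cls[OF j] by simp
  qed
  moreover have "(\<Sum>j\<in>J. card (colour_class ?s j) - 1) = CARD('d)"
    using cls card_eq_sum_colour_classes[OF TI] cardT cardC by simp
  moreover have "?s \<subseteq> I" using TI r by auto
  ultimately show ?thesis using ci by blast
qed

end

section \<open>Minkowski sums of lattice polytopes\<close>

text \<open>Upper bounds \<open>n x\<close> replace exact degrees, so that factors of smaller
  degree, the zero polynomial included, are covered.\<close>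

lemma coeff_prod_of_degree_le:
  fixes p :: "'a \<Rightarrow> 'b::comm_semiring_1 poly"
  assumes "finite A" "\<And>x. x \<in> A \<Longrightarrow> degree (p x) \<le> n x"
  shows "degree (prod p A) \<le> sum n A \<and> coeff (prod p A) (sum n A) = (\<Prod>x\<in>A. coeff (p x) (n x))"
  using assms
proof (induction A rule: finite_induct)
  case (insert x A)
  then have IH: "degree (prod p A) \<le> sum n A" "coeff (prod p A) (sum n A) = (\<Prod>x\<in>A. coeff (p x) (n x))"
    and x: "degree (p x) \<le> n x" by auto
  have "coeff (p x * prod p A) (n x + sum n A) =
      (\<Sum>i\<le>n x + sum n A. coeff (p x) i * coeff (prod p A) (n x + sum n A - i))"
    by (rule coeff_mult)
  also have "\<dots> = (\<Sum>i\<in>{n x}. coeff (p x) i * coeff (prod p A) (n x + sum n A - i))"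
  proof (rule sum.mono_neutral_right)
    show "\<forall>i\<in>{..n x + sum n A} - {n x}. coeff (p x) i * coeff (prod p A) (n x + sum n A - i) = 0"
    proof
      fix i assume i: "i \<in> {..n x + sum n A} - {n x}"
      show "coeff (p x) i * coeff (prod p A) (n x + sum n A - i) = 0"
      proof (cases "i > n x")
        case True
        then show ?thesis using x by (simp add: coeff_eq_0)
      next
        case False
        then have "n x + sum n A - i > degree (prod p A)" using i IH(1) by auto
        then show ?thesis by (simp add: coeff_eq_0)
      qed
    qed
  qed auto
  finally show ?case
    using insert.hyps IH x degree_mult_le[of "p x" "prod p A"] by simp
qed simp

section \<open>Dilates and the Cayley trick\<close>

lemma dilate_0: "A \<noteq> {} \<Longrightarrow> dilate 0 A = 0"
  by (auto simp: dilate_def)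

lemma mem_dilate_convex_hull:
  assumes S: "finite S" "S \<noteq> {}"
  shows "x \<in> dilate n (convex hull S) \<longleftrightarrow>
    (\<exists>c. (\<forall>v\<in>S. 0 \<le> c v) \<and> sum c S = real n \<and> (\<Sum>v\<in>S. c v *\<^sub>R v) = x)" (is "_ \<longleftrightarrow> ?R")
proof
  assume "x \<in> dilate n (convex hull S)"
  then obtain u where u: "\<forall>v\<in>S. 0 \<le> u v" "sum u S = 1" "x = real n *\<^sub>R (\<Sum>v\<in>S. u v *\<^sub>R v)"
    by (auto simp: dilate_def convex_hull_finite[OF S(1)])
  then show ?R
    by (intro exI[of _ "\<lambda>v. real n * u v"]) (simp add: scaleR_right.sum flip: sum_distrib_left)
next
  assume ?R
  then obtain c where c: "\<forall>v\<in>S. 0 \<le> c v" "sum c S = real n" "(\<Sum>v\<in>S. c v *\<^sub>R v) = x" by blast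
  show "x \<in> dilate n (convex hull S)"
  proof (cases "n = 0")
    \<comment> \<open>Division by \<open>n\<close> is impossible here, but nonnegative coefficients
      with sum 0 all vanish.\<close>
    case True
    then have "\<forall>v\<in>S. c v = 0" using c(1,2) S by (simp add: sum_nonneg_eq_0_iff)
    then have "x = 0" using c(3) by auto
    then show ?thesis using True S(2) by (simp add: dilate_0)
  next
    case False
    have "(\<Sum>v\<in>S. (c v / real n) *\<^sub>R v) \<in> convex hull S"
      unfolding convex_hull_finite[OF S(1)] using c(1,2) False
      by (intro CollectI exI[of _ "\<lambda>v. c v / real n"]) (auto simp flip: sum_divide_distrib)
    moreover have "real n *\<^sub>R (\<Sum>v\<in>S. (c v / real n) *\<^sub>R v) = x"
      using False c(3) by (simp add: scaleR_right.sum)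
    ultimately show ?thesis unfolding dilate_def by blast
  qed
qed

lemma dilate_dilate: "dilate n (dilate r A) = dilate (n * r) A"
  by (simp add: dilate_def image_image)

lemma dilate_sum:
  fixes A :: "'a \<Rightarrow> (real ^ 'd) set"
  assumes "finite K"
  shows "dilate n (\<Sum>j\<in>K. A j) = (\<Sum>j\<in>K. dilate n (A j))"
  using assms
proof (induction K rule: finite_induct)
  case empty
  then show ?case by (simp add: dilate_def)
next
  case (insert j K)
  have "dilate n (B + C) = dilate n B + dilate n C" for B C :: "(real ^ 'd) set"
  proof (intro equalityI subsetI)
    fix x assume "x \<in> dilate n (B + C)"
    then obtain b c where "b \<in> B" "c \<in> C" "x = real n *\<^sub>R b + real n *\<^sub>R c"
      by (auto simp: dilate_def scaleR_add_right elim!: set_plus_elim)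
    then show "x \<in> dilate n B + dilate n C" by (auto simp: dilate_def)
  next
    fix x assume "x \<in> dilate n B + dilate n C"
    then obtain b c where "b \<in> B" "c \<in> C" "x = real n *\<^sub>R (b + c)"
      by (auto simp: dilate_def scaleR_add_right elim!: set_plus_elim)
    then show "x \<in> dilate n (B + C)" unfolding dilate_def by (intro image_eqI[of _ _ "b + c"]) auto
  qed
  then show ?case using insert by simp
qed

lemma ehrhart_polyI:
  assumes "\<And>n::nat. poly p (real n) = real (card (dilate n P \<inter> integer_points))"
  shows "ehrhart_poly P = p"
  unfolding ehrhart_poly_def
proof (rule the_equality)
  fix q :: "real poly" assume "\<forall>n::nat. poly q (real n) = real (card (dilate n P \<inter> integer_points))"
  then show "q = p" using assms by (intro poly_eq_if_eq_on_large_nats[of 0]) simp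
qed (use assms in blast)

locale polytope_family =
  fixes J :: "'c set" and S :: "'c \<Rightarrow> (real ^ 'd) set"
  assumes J: "finite J" and S: "\<And>j. j \<in> J \<Longrightarrow> finite (S j) \<and> S j \<noteq> {} \<and> S j \<subseteq> integer_points"
begin

text \<open>Pairing each point with its colour keeps apart the copies of a point that is shared by
  several polytopes.\<close>

sublocale coloured_points "SIGMA j:J. S j" snd fst "J"
proof
  show "finite (SIGMA j:J. S j)" using J S by (intro finite_SigmaI) simp_all
  show "snd ` (SIGMA j:J. S j) \<subseteq> integer_points"
  proof clarify
    fix x and j v assume "j \<in> J" "v \<in> S j"
    then show "snd (j, v) \<in> integer_points" using S[of j] by auto
  qed
qed (use J in auto)

abbreviation I where "I \<equiv> SIGMA j:J. S j"

lemma colour_sum: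
  assumes "j \<in> J"
  shows "(\<Sum>i | i \<in> I \<and> fst i = j. f i) = (\<Sum>v\<in>S j. f (j, v))"
  by (rule sum.reindex_bij_witness[of _ "\<lambda>v. (j, v)" snd]) (use assms in auto)

lemma pt_eq: "pt c = (\<Sum>j\<in>J. \<Sum>v\<in>S j. c (j, v) *\<^sub>R v)"
  unfolding pt_def by (subst sum.Sigma) (use S J in \<open>auto intro!: sum.cong\<close>)

text \<open>The Cayley trick: coefficients of colour \<open>j\<close> with total mass
  \<open>m j\<close> describe exactly a point of the \<open>m j\<close>-fold dilate of the polytope
  with index \<open>j\<close>.\<close>

lemma reps_nonempty_iff:
  "reps (\<lambda>j. real (m j)) x \<noteq> {} \<longleftrightarrow> x \<in> (\<Sum>j\<in>J. dilate (m j) (convex hull (S j)))"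
proof
  assume "reps (\<lambda>j. real (m j)) x \<noteq> {}"
  then obtain c where c: "\<forall>i. 0 \<le> c i" "\<forall>j\<in>J. mass c j = real (m j)" "pt c = x"
    by (auto simp: reps_def)
  have "(\<Sum>v\<in>S j. c (j, v) *\<^sub>R v) \<in> dilate (m j) (convex hull (S j))" if j: "j \<in> J" for j
    using c j S[OF j] by (subst mem_dilate_convex_hull)
      (auto simp: mass_def colour_sum intro!: exI[of _ "\<lambda>v. c (j, v)"])
  then show "x \<in> (\<Sum>j\<in>J. dilate (m j) (convex hull (S j)))"
    using c(3) by (auto simp: set_sum_alt[OF J] pt_eq)
next
  assume "x \<in> (\<Sum>j\<in>J. dilate (m j) (convex hull (S j)))"
  then obtain y where y: "x = sum y J" "\<And>j. j \<in> J \<Longrightarrow> y j \<in> dilate (m j) (convex hull (S j))"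
    by (auto simp: set_sum_alt[OF J])
  have "\<exists>c. (\<forall>v\<in>S j. 0 \<le> c v) \<and> sum c (S j) = real (m j) \<and> (\<Sum>v\<in>S j. c v *\<^sub>R v) = y j"
    if "j \<in> J" for j
    using y(2)[OF that] mem_dilate_convex_hull S[OF that] by blast
  then obtain c where c: "\<And>j. j \<in> J \<Longrightarrow> (\<forall>v\<in>S j. 0 \<le> c j v) \<and> sum (c j) (S j) = real (m j) \<and>
      (\<Sum>v\<in>S j. c j v *\<^sub>R v) = y j" by metis
  define \<theta> where "\<theta> i = (if i \<in> I then c (fst i) (snd i) else 0)" for i
  have "\<theta> \<in> reps (\<lambda>j. real (m j)) x"
    using c y(1) unfolding reps_def mass_def pt_eq
    by (auto simp: \<theta>_def colour_sum intro!: sum.cong)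
  then show "reps (\<lambda>j. real (m j)) x \<noteq> {}" by blast
qed

text \<open>A subfamily is obtained by giving the remaining colours mass 0; this is why the counting
  formula is needed at 0.\<close>

lemma dilate_partial_sum:
  assumes K: "K \<subseteq> J"
  shows "dilate n (\<Sum>j\<in>K. convex hull (S j)) \<inter> integer_points = pts (\<lambda>j. if j \<in> K then n else 0)"
proof -
  have "dilate n (\<Sum>j\<in>K. convex hull (S j)) = (\<Sum>j\<in>K. dilate n (convex hull (S j)))"
    using K by (intro dilate_sum) (auto intro: finite_subset[OF _ J])
  also have "\<dots> = (\<Sum>j\<in>J. dilate (if j \<in> K then n else 0) (convex hull (S j)))"
    by (rule sum.mono_neutral_cong_left) (use J K S in \<open>auto simp: dilate_0\<close>)
  finally show ?thesis by (auto simp: pts_def reps_nonempty_iff)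
qed

end

lemma span_differences_UNIV:
  fixes S :: "'a::euclidean_space set"
  assumes "aff_dim S = int DIM('a)" "a \<in> S"
  shows "span ((\<lambda>x. x - a) ` S) = UNIV"
proof -
  have "UNIV = (\<lambda>x. a + x) ` span ((\<lambda>x. - a + x) ` S)"
    using affine_hull_span_gen[of a S] assms aff_dim_eq_full[of S] by (simp add: hull_inc)
  then have "y \<in> span ((\<lambda>x. - a + x) ` S)" for y
    by (metis UNIV_I add_left_cancel imageE)
  then show ?thesis by auto
qed

lemma smult_sum_right: "smult c (sum f A) = (\<Sum>x\<in>A. smult c (f x))"
  by (induction A rule: infinite_finite_induct) (simp_all add: smult_add_right)

section \<open>The mixed Ehrhart polynomial as a sum over cells\<close>

context polytope_family
begin

lemma fst_I: "fst ` I = J"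
  using S by force

text \<open>Dilation by \<open>r\<close> is the substitution of \<open>r n\<close> for
  \<open>n\<close>. Colours outside \<open>K\<close> are kept as constant factors, so that the sums
  for all \<open>K\<close> run over the same cells.\<close>

lemma ehrhart_poly_partial_sum:
  assumes L: "0 \<notin> snd ` set L" "fst ` set L = I" and K: "K \<subseteq> J"
  shows "ehrhart_poly (\<Sum>j\<in>K. dilate r (convex hull (S j))) =
    pcompose (\<Sum>\<sigma> | \<sigma> \<subseteq> I \<and> good L \<sigma> \<and> J \<subseteq> fst ` \<sigma>. \<Sum>b\<in>unit_box \<sigma> {}.
      (\<Prod>j\<in>K. cell_poly \<sigma> b j) * (\<Prod>j\<in>J - K. [:poly (cell_poly \<sigma> b j) 0:])) [:0, real r:]"
    (is "_ = pcompose ?p _")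
proof (rule ehrhart_polyI)
  fix n
  have finK: "finite K" using K J by (rule finite_subset)
  have split: "(\<Prod>j\<in>J. poly (cell_poly \<sigma> b j) (real (if j \<in> K then n * r else 0))) =
      (\<Prod>j\<in>K. poly (cell_poly \<sigma> b j) (real (n * r))) * (\<Prod>j\<in>J - K. poly (cell_poly \<sigma> b j) 0)" for \<sigma> b
    by (subst prod.subset_diff[OF K J]) simp
  have "dilate n (\<Sum>j\<in>K. dilate r (convex hull (S j))) = dilate (n * r) (\<Sum>j\<in>K. convex hull (S j))"
    by (simp add: dilate_sum[OF finK] dilate_dilate)
  then have "real (card (dilate n (\<Sum>j\<in>K. dilate r (convex hull (S j))) \<inter> integer_points)) =
      (\<Sum>\<sigma> | \<sigma> \<subseteq> I \<and> good L \<sigma> \<and> J \<subseteq> fst ` \<sigma>. \<Sum>b\<in>unit_box \<sigma> {}.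
        \<Prod>j\<in>J. poly (cell_poly \<sigma> b j) (real (if j \<in> K then n * r else 0)))"
    by (simp only: dilate_partial_sum[OF K] card_pts_eq_poly[OF L fst_I])
  also have "\<dots> = poly ?p (real (n * r))"
    by (simp only: split poly_sum poly_mult poly_prod poly_pCons poly_0 mult_zero_right add_0_right)
  finally show "poly (pcompose ?p [:0, real r:]) (real n) =
      real (card (dilate n (\<Sum>j\<in>K. dilate r (convex hull (S j))) \<inter> integer_points))"
    by (simp only: poly_pcompose poly_pCons poly_0 mult_zero_right add_0_right add_0_left of_nat_mult)
qed

definition mixed_poly :: "(('c \<times> (real ^ 'd)) \<times> real) list \<Rightarrow> real poly" where
  "mixed_poly L = (\<Sum>\<sigma> | \<sigma> \<subseteq> I \<and> good L \<sigma> \<and> J \<subseteq> fst ` \<sigma>. \<Sum>b\<in>unit_box \<sigma> {}.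
     \<Prod>j\<in>J. cell_poly \<sigma> b j - [:poly (cell_poly \<sigma> b j) 0:])"

text \<open>
  In each cell the alternating sum over \<open>K\<close> factors over the colours, so only cells with at least
  two points of every colour survive.
\<close>

lemma alternating_sum_ehrhart_poly:
  assumes L: "0 \<notin> snd ` set L" "fst ` set L = I"
  shows "(\<Sum>K\<in>Pow J. smult ((-1) ^ (card J - card K)) (ehrhart_poly (\<Sum>j\<in>K. dilate r (convex hull (S j))))) =
    pcompose (mixed_poly L) [:0, real r:]"
proof -
  let ?C = "{\<sigma>. \<sigma> \<subseteq> I \<and> good L \<sigma> \<and> J \<subseteq> fst ` \<sigma>}"
  let ?e = "\<lambda>K. (-1 :: real) ^ (card J - card K)"
  let ?t = "\<lambda>K \<sigma> b. (\<Prod>j\<in>K. cell_poly \<sigma> b j) * (\<Prod>j\<in>J - K. [:poly (cell_poly \<sigma> b j) 0:])"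
  \<comment> \<open>Expanding the product of differences gives one term for each set
    \<open>K\<close> of colours, with the sign it has in the alternating sum.\<close>
  have "mixed_poly L = (\<Sum>\<sigma>\<in>?C. \<Sum>b\<in>unit_box \<sigma> {}. \<Sum>K\<in>Pow J. smult (?e K) (?t K \<sigma> b))"
    unfolding mixed_poly_def prod_diff_conv_sum'[OF J]
    by (intro sum.cong refl) (simp add: minus_one_power_iff mult.assoc)
  also have "\<dots> = (\<Sum>\<sigma>\<in>?C. \<Sum>K\<in>Pow J. \<Sum>b\<in>unit_box \<sigma> {}. smult (?e K) (?t K \<sigma> b))"
    by (rule sum.cong[OF refl]) (rule sum.swap)
  also have "\<dots> = (\<Sum>K\<in>Pow J. \<Sum>\<sigma>\<in>?C. \<Sum>b\<in>unit_box \<sigma> {}. smult (?e K) (?t K \<sigma> b))"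
    by (rule sum.swap)
  finally have "mixed_poly L = (\<Sum>K\<in>Pow J. smult (?e K) (\<Sum>\<sigma>\<in>?C. \<Sum>b\<in>unit_box \<sigma> {}. ?t K \<sigma> b))"
    by (simp add: smult_sum_right)
  then have "pcompose (mixed_poly L) [:0, real r:] =
      (\<Sum>K\<in>Pow J. smult (?e K) (pcompose (\<Sum>\<sigma>\<in>?C. \<Sum>b\<in>unit_box \<sigma> {}. ?t K \<sigma> b) [:0, real r:]))"
    by (simp only: pcompose_sum pcompose_smult)
  also have "\<dots> = (\<Sum>K\<in>Pow J. smult (?e K) (ehrhart_poly (\<Sum>j\<in>K. dilate r (convex hull (S j)))))"
    by (intro sum.cong refl arg_cong2[where f = smult] ehrhart_poly_partial_sum[OF L, symmetric]) auto
  finally show ?thesis ..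
qed

text \<open>First an independent set \<open>\<rho>\<close> of full size with two points of every
  colour is found, then an order that makes it good. Independence bounds the degree on all cells.
  Products of full degree have nonnegative leading coefficients, and that of \<open>\<rho>\<close>
  is positive.\<close>

lemma mixed_poly_coeffs:
  assumes aff: "\<And>j. j \<in> J \<Longrightarrow> aff_dim (S j) = int CARD('d)"
    and J': "card J \<le> CARD('d)" "J \<noteq> {}"
  shows "\<exists>L. 0 \<notin> snd ` set L \<and> fst ` set L = I \<and> degree (mixed_poly L) \<le> CARD('d) \<and>
    poly (mixed_poly L) 0 = 0 \<and> coeff (mixed_poly L) CARD('d) > 0"
proof -
  have "\<exists>v. v \<in> S j" if "j \<in> J" for j using S[OF that] by auto
  then obtain v where v: "\<And>j. j \<in> J \<Longrightarrow> v j \<in> S j" by metis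
  define r where "r j = (j, v j)" for j
  have r: "r j \<in> I \<and> fst (r j) = j" if "j \<in> J" for j using v[OF that] that by (simp add: r_def)
  have span: "span (edge r ` colour_class I j) = UNIV" if j: "j \<in> J" for j
  proof -
    have "edge r ` colour_class I j = (\<lambda>x. x - v j) ` S j"
      using j by (force simp: edge_def colour_class_def r_def image_iff)
    then show ?thesis using span_differences_UNIV[of "S j" "v j"] aff[OF j] v[OF j] by simp
  qed
  obtain \<rho> where rho: "\<rho> \<subseteq> I" "coloured_independent \<rho>" "\<And>j. j \<in> J \<Longrightarrow> card (colour_class \<rho> j) \<ge> 2"
    "(\<Sum>j\<in>J. card (colour_class \<rho> j) - 1) = CARD('d)"
    using exists_mixed_coloured_independent[OF r span J'] by blast
  obtain L where L: "0 \<notin> snd ` set L" "fst ` set L = I" and grho: "good L \<rho>"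
    using good_if_coloured_independent[OF rho(1,2)] by blast
  let ?C = "{\<sigma>. \<sigma> \<subseteq> I \<and> good L \<sigma> \<and> J \<subseteq> fst ` \<sigma>}"
  define a where "a \<sigma> j = card (colour_class \<sigma> j) - 1" for \<sigma> j
  define g where "g \<sigma> b j = cell_poly \<sigma> b j - [:poly (cell_poly \<sigma> b j) 0:]" for \<sigma> b j
  have deg_g: "degree (g \<sigma> b j) \<le> a \<sigma> j" for \<sigma> b j
    unfolding g_def cell_poly_def a_def
    by (rule degree_diff_le) (simp_all add: degree_binom_poly)
  \<comment> \<open>In degree 0 the cell polynomial is constant, and subtracting its value at 0
    leaves nothing.\<close>
  have coeff_g: "coeff (g \<sigma> b j) (a \<sigma> j) = (if a \<sigma> j = 0 then 0 else 1 / fact (a \<sigma> j))" for \<sigma> b j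
    using lead_coeff_binom_poly[of "a \<sigma> j" "shift b j"]
    by (auto simp: g_def cell_poly_def a_def degree_binom_poly poly_0_coeff_0 coeff_pCons split: nat.splits)
  note prod_g = coeff_prod_of_degree_le[OF J, of "g \<sigma> b" "a \<sigma>" for \<sigma> b, OF deg_g]
  have sum_a: "(\<Sum>j\<in>J. a \<sigma> j) \<le> CARD('d)" if "\<sigma> \<in> ?C" for \<sigma>
    unfolding a_def
    by (rule coloured_independent_card_le) (use that good_imp_coloured_independent[OF L] in auto)
  have deg: "degree (\<Prod>j\<in>J. g \<sigma> b j) \<le> CARD('d)" if "\<sigma> \<in> ?C" for \<sigma> b
    using prod_g[of \<sigma> b] sum_a[OF that] by linarith
  have nonneg: "0 \<le> coeff (\<Prod>j\<in>J. g \<sigma> b j) CARD('d)" if "\<sigma> \<in> ?C" for \<sigma> b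
  proof (cases "(\<Sum>j\<in>J. a \<sigma> j) = CARD('d)")
    case True
    then have "coeff (\<Prod>j\<in>J. g \<sigma> b j) CARD('d) = (\<Prod>j\<in>J. coeff (g \<sigma> b j) (a \<sigma> j))"
      using prod_g[of \<sigma> b] by simp
    also have "\<dots> \<ge> 0" by (intro prod_nonneg) (simp add: coeff_g)
    finally show ?thesis .
  next
    case False
    then have "degree (\<Prod>j\<in>J. g \<sigma> b j) < CARD('d)"
      using prod_g[of \<sigma> b] sum_a[OF that] by linarith
    then show ?thesis by (simp add: coeff_eq_0)
  qed
  have pos: "0 < coeff (\<Prod>j\<in>J. g \<rho> b j) CARD('d)" for b
  proof -
    have "coeff (\<Prod>j\<in>J. g \<rho> b j) CARD('d) = (\<Prod>j\<in>J. coeff (g \<rho> b j) (a \<rho> j))"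
      using prod_g[of \<rho> b] rho(4) by (simp add: a_def)
    also have "\<dots> > 0"
    proof (rule prod_pos)
      fix j assume "j \<in> J"
      then have "a \<rho> j \<noteq> 0" using rho(3)[of j] by (simp add: a_def)
      then show "0 < coeff (g \<rho> b j) (a \<rho> j)" by (simp add: coeff_g)
    qed
    finally show ?thesis .
  qed
  have fin: "finite ?C" using finI by simp
  have fin_box: "finite (unit_box \<sigma> {})" if "\<sigma> \<in> ?C" for \<sigma>
    by (rule finite_unit_box[OF L]) (use that in auto)
  have M: "mixed_poly L = (\<Sum>\<sigma>\<in>?C. \<Sum>b\<in>unit_box \<sigma> {}. \<Prod>j\<in>J. g \<sigma> b j)"
    by (simp add: mixed_poly_def g_def)
  have rhoC: "\<rho> \<in> ?C"
  proof -
    have "j \<in> fst ` \<rho>" if "j \<in> J" for j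
    proof -
      have "colour_class \<rho> j \<noteq> {}" using rho(3)[OF that] by auto
      then show ?thesis by (force simp: colour_class_def)
    qed
    then show ?thesis using rho(1) grho by auto
  qed
  \<comment> \<open>The point with all coefficients 1 shows that the box of \<open>\<rho>\<close> is
    nonempty, so that its sum is positive.\<close>
  have box: "(\<lambda>i. if i \<in> \<rho> then 1 else 0) \<in> unit_box \<rho> {}" (is "?b \<in> _")
  proof -
    have "?b = (\<lambda>i. real (if i \<in> \<rho> then 1 else 0))" by auto
    then have "pt ?b \<in> integer_points" using pt_of_nat by metis
    moreover have "mass ?b j \<in> \<int>" for j unfolding mass_def by (rule Ints_sum) simp
    ultimately show ?thesis by (simp add: unit_box_def)
  qed
  have "degree (mixed_poly L) \<le> CARD('d)"
    unfolding M by (intro degree_sum_le fin fin_box deg)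
  moreover have "poly (mixed_poly L) 0 = 0"
    unfolding M poly_sum poly_prod
    by (intro sum.neutral ballI prod_zero[OF J]) (use J'(2) in \<open>auto simp: g_def\<close>)
  moreover have "coeff (mixed_poly L) CARD('d) > 0"
    unfolding M coeff_sum
  proof (rule sum_pos2[OF fin rhoC])
    show "0 < (\<Sum>b\<in>unit_box \<rho> {}. coeff (\<Prod>j\<in>J. g \<rho> b j) CARD('d))"
      by (rule sum_pos) (use fin_box[OF rhoC] box pos in auto)
    show "0 \<le> (\<Sum>b\<in>unit_box \<sigma> {}. coeff (\<Prod>j\<in>J. g \<sigma> b j) CARD('d))" if "\<sigma> \<in> ?C" for \<sigma>
      by (rule sum_nonneg) (rule nonneg[OF that])
  qed
  ultimately show ?thesis using L by blast
qed

end

text \<open>The order \<open>L\<close> does not depend on \<open>r\<close>, so a single polynomial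
  \<open>f\<close> serves all dilations.\<close>

theorem mixed_ehrhart_poly_dilate:
  fixes P :: "nat \<Rightarrow> (real ^ 'd) set" and k :: nat
  assumes k: "1 \<le> k" "k \<le> CARD('d)"
    and lat: "\<And>j. j \<in> {1..k} \<Longrightarrow> lattice_polytope (P j)"
    and dim: "\<And>j. j \<in> {1..k} \<Longrightarrow> aff_dim (P j) = int CARD('d)"
  shows "\<exists>f. degree f \<le> CARD('d) \<and> poly f 0 = 0 \<and> coeff f CARD('d) > 0 \<and>
    (\<forall>r. mixed_ehrhart_poly k (\<lambda>j. dilate r (P j)) = pcompose f [:0, real r:])"
proof -
  have "\<exists>T. finite T \<and> T \<noteq> {} \<and> T \<subseteq> integer_points \<and> P j = convex hull T" if "j \<in> {1..k}" for j
    using lat[OF that] by (simp add: lattice_polytope_def)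
  then obtain S where PS: "\<And>j. j \<in> {1..k} \<Longrightarrow>
      finite (S j) \<and> S j \<noteq> {} \<and> S j \<subseteq> integer_points \<and> P j = convex hull (S j)" by metis
  interpret polytope_family "{1..k}" S
  proof
    show "finite {1..k}" by simp
    show "finite (S j) \<and> S j \<noteq> {} \<and> S j \<subseteq> integer_points" if "j \<in> {1..k}" for j
      using PS[OF that] by blast
  qed
  have "card {1..k} \<le> CARD('d)" "{1..k} \<noteq> {}" using k by simp_all
  moreover have "aff_dim (S j) = int CARD('d)" if "j \<in> {1..k}" for j
    using dim[OF that] PS[OF that] by (simp add: aff_dim_convex_hull)
  ultimately obtain L where L: "0 \<notin> snd ` set L" "fst ` set L = I" and
    f: "degree (mixed_poly L) \<le> CARD('d)" "poly (mixed_poly L) 0 = 0" "coeff (mixed_poly L) CARD('d) > 0"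
    using mixed_poly_coeffs by blast
  have "mixed_ehrhart_poly k (\<lambda>j. dilate r (P j)) = pcompose (mixed_poly L) [:0, real r:]" for r
  proof -
    have "(\<Sum>j\<in>K. dilate r (P j)) = (\<Sum>j\<in>K. dilate r (convex hull (S j)))" if "K \<subseteq> {1..k}" for K
    proof (rule sum.cong[OF refl])
      fix j assume "j \<in> K"
      then have "j \<in> {1..k}" using that by blast
      then show "dilate r (P j) = dilate r (convex hull (S j))" using PS by simp
    qed
    then show ?thesis
      unfolding alternating_sum_ehrhart_poly[OF L, symmetric] mixed_ehrhart_poly_def
      by (intro sum.cong refl) (simp add: Pow_def)
  qed
  with f show ?thesis by blast
qed

section \<open>Eulerian polynomials and the binomial basis\<close>

text \<open>The recurrence that results from applying \<open>z d/dz\<close> to the generating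
  function of \<open>n ^ d\<close>.\<close>

fun eulerian :: "nat \<Rightarrow> real poly" where
  "eulerian 0 = 1"
| "eulerian (Suc n) = pCons 0 ([:1, -1:] * pderiv (eulerian n) + smult (real n + 1) (eulerian n))"

text \<open>The next Eulerian polynomial without its factor \<open>z\<close>; note the shift of the
  index.\<close>

definition reduced_eulerian :: "nat \<Rightarrow> real poly" where
  "reduced_eulerian n = [:1, -1:] * pderiv (eulerian n) + smult (real n + 1) (eulerian n)"

lemma eulerian_Suc: "eulerian (Suc n) = pCons 0 (reduced_eulerian n)"
  by (simp add: reduced_eulerian_def)

text \<open>The leading coefficient stays 1, because the derivative term contributes
  \<open>- n\<close> and the other term \<open>n + 1\<close>.\<close>

lemma degree_eulerian: "degree (eulerian n) \<le> n \<and> coeff (eulerian n) n = 1"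
proof (induction n)
  case (Suc n)
  have d: "degree (pderiv (eulerian n)) \<le> n - 1" using Suc by (simp add: degree_pderiv diff_le_mono)
  have "degree (reduced_eulerian n) \<le> n"
    unfolding reduced_eulerian_def
  proof (rule degree_add_le)
    show "degree ([:1, -1:] * pderiv (eulerian n)) \<le> n"
    proof (cases n)
      case (Suc m)
      then show ?thesis using degree_mult_le[of "[:1, -1:]" "pderiv (eulerian n)"] d by simp
    qed (simp add: pderiv_1)
  qed (use Suc in \<open>auto intro: order.trans[OF degree_smult_le]\<close>)
  moreover have "coeff (reduced_eulerian n) n = 1"
  proof (cases n)
    case (Suc m)
    have "coeff (eulerian n) (Suc n) = 0" using Suc.IH by (simp add: coeff_eq_0)
    then show ?thesis
      using Suc Suc.IH by (simp add: reduced_eulerian_def coeff_pderiv)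
  qed (simp add: reduced_eulerian_def pderiv_1)
  ultimately show ?case unfolding eulerian_Suc by (auto intro: order.trans[OF degree_pCons_le])
qed simp

lemma degree_reduced_eulerian: "degree (reduced_eulerian n) \<le> n" "coeff (reduced_eulerian n) n = 1"
  using degree_eulerian[of "Suc n"] unfolding eulerian_Suc
  by (auto simp: degree_pCons_eq_if split: if_splits)

text \<open>In the induction step \<open>fps_X * fps_deriv\<close> raises the exponent in the series
  by 1, and the product rule for the denominator yields the recurrence.\<close>

lemma eulerian_fps:
  "Abs_fps (\<lambda>m. real m ^ n) * (1 - fps_X) ^ (n + 1) = fps_of_poly (eulerian n)"
proof (induction n)
  case 0
  have "Abs_fps (\<lambda>m. 1) * (1 - fps_X) = (1 :: real fps)"
    by (rule fps_ext) (simp add: right_diff_distrib fps_X_mult_right_nth)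
  then show ?case by simp
next
  case (Suc n)
  let ?F = "\<lambda>n. Abs_fps (\<lambda>m. real m ^ n)" and ?Q = "1 - fps_X :: real fps"
  let ?E = "fps_of_poly (eulerian n)"
  have F: "?F (Suc n) = fps_X * fps_deriv (?F n)"
    by (rule fps_ext) simp
  have dQ: "fps_deriv (?Q ^ (n + 1)) = - fps_const (real n + 1) * ?Q ^ n"
    using fps_deriv_power[of ?Q "n + 1"] by (simp del: power_Suc)
  have alg0: "f * (- N * s) + f' * q = f' * q - N * f * s" for f f' q s N :: "real fps"
    by (simp add: algebra_simps)
  have D: "fps_deriv ?E = fps_deriv (?F n) * ?Q ^ (n + 1) - fps_const (real n + 1) * ?F n * ?Q ^ n"
    unfolding Suc.IH[symmetric] fps_deriv_mult dQ by (rule alg0)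
  have alg: "q * (f' * (q * s) - N * f * s) + N * (f * (q * s)) = f' * (q * (q * s))"
    for q f f' s N :: "real fps" by (simp add: algebra_simps)
  have "fps_X * (?Q * fps_deriv ?E + fps_const (real n + 1) * ?E) = fps_X * fps_deriv (?F n) * ?Q ^ (Suc n + 1)"
    unfolding D unfolding Suc.IH[symmetric]
    using alg[of ?Q "fps_deriv (?F n)" "?Q ^ n" "fps_const (real n + 1)" "?F n"]
    by (simp only: add_Suc_right add_0_right One_nat_def power_Suc mult.assoc add_Suc add_0)
  also have "\<dots> = ?F (Suc n) * ?Q ^ (Suc n + 1)" by (simp only: F)
  finally have "?F (Suc n) * ?Q ^ (Suc n + 1) = fps_X * (?Q * fps_deriv ?E + fps_const (real n + 1) * ?E)" ..
  also have "\<dots> = fps_of_poly (eulerian (Suc n))"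
    by (simp add: fps_of_poly_pCons fps_of_poly_add fps_of_poly_mult fps_of_poly_smult fps_of_poly_pderiv fps_of_poly_uminus
        algebra_simps del: fps_const_add)
  finally show ?case .
qed

lemma eq_mult_inverse_iff:
  fixes F G U :: "real fps"
  assumes "fps_nth U 0 \<noteq> 0"
  shows "F = G * inverse U \<longleftrightarrow> F * U = G"
  using inverse_mult_eq_1[OF assms] inverse_mult_eq_1'[OF assms]
  by (auto simp: mult.assoc)

lemma eulerian_poly_eq: "eulerian_poly n = eulerian n"
  unfolding eulerian_poly_def
proof (rule the_equality)
  have u: "fps_nth ((1 - fps_X :: real fps) ^ (n + 1)) 0 \<noteq> 0" by (simp add: fps_nth_power_0)
  have div: "(F = G / (1 - fps_X) ^ (n + 1)) \<longleftrightarrow> F * (1 - fps_X) ^ (n + 1) = G" for F G :: "real fps"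
    unfolding fps_divide_unit[OF u] by (rule eq_mult_inverse_iff[OF u])
  show "Abs_fps (\<lambda>m. real m ^ n) = fps_of_poly (eulerian n) / (1 - fps_X) ^ (n + 1)"
    unfolding div by (rule eulerian_fps)
  show "A = eulerian n" if "Abs_fps (\<lambda>m. real m ^ n) = fps_of_poly A / (1 - fps_X) ^ (n + 1)" for A
    using that unfolding div eulerian_fps by (simp add: fps_of_poly_eq_iff)
qed

section \<open>Binomial basis and generating functions\<close>

text \<open>The inverse of \<open>(1 - X) ^ (d + 1)\<close> has the coefficients
  \<open>(d + k) choose d\<close>, so a binomial expansion is a product of series. The equivalence
  provides existence and uniqueness of the vector at once.\<close>

lemma binomial_basis_iff_fps:
  fixes h a :: "nat \<Rightarrow> real"
  assumes h: "\<And>i. i > d \<Longrightarrow> h i = 0"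
  shows "(\<forall>n. a n = (\<Sum>i\<le>d. h i * real ((n + d - i) choose d))) \<longleftrightarrow>
    Abs_fps a * (1 - fps_X) ^ (d + 1) = Abs_fps h"
proof -
  let ?Q = "(1 - fps_X :: real fps) ^ (d + 1)"
  have u: "fps_nth ?Q 0 \<noteq> 0" by (simp add: fps_nth_power_0)
  have inv: "inverse ?Q = Abs_fps (\<lambda>k. real ((d + k) choose k))"
    using one_minus_const_fps_X_neg_power'[of "d + 1" "1 :: real"] by simp
  have "(\<Sum>i\<le>d. h i * real ((n + d - i) choose d)) = fps_nth (Abs_fps h * inverse ?Q) n" for n
  proof -
    have "fps_nth (Abs_fps h * inverse ?Q) n = (\<Sum>i=0..n. h i * real ((d + (n - i)) choose (n - i)))"
      unfolding inv by (simp add: fps_mult_nth)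
    also have "\<dots> = (\<Sum>i\<in>{..d} \<inter> {..n}. h i * real ((n + d - i) choose d))"
    proof (rule sum.mono_neutral_cong_right)
      fix i assume "i \<in> {..d} \<inter> {..n}"
      then have "d + (n - i) = n + d - i" by auto
      then show "h i * real (d + (n - i) choose (n - i)) = h i * real (n + d - i choose d)"
        using binomial_symmetric[of d "d + (n - i)"] by simp
    qed (use h in auto)
    \<comment> \<open>For \<open>n < i \<le> d\<close> the binomial coefficient vanishes, its upper
      entry being below \<open>d\<close>.\<close>
    also have "\<dots> = (\<Sum>i\<le>d. h i * real ((n + d - i) choose d))"
      by (rule sum.mono_neutral_left) (auto simp: binomial_eq_0)
    finally show ?thesis ..
  qed
  then have "(\<forall>n. a n = (\<Sum>i\<le>d. h i * real ((n + d - i) choose d))) \<longleftrightarrow> Abs_fps a = Abs_fps h * inverse ?Q"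
    by (simp add: fps_eq_iff)
  also have "\<dots> \<longleftrightarrow> Abs_fps a * ?Q = Abs_fps h"
    by (rule eq_mult_inverse_iff[OF u])
  finally show ?thesis .
qed

text \<open>The numerator that arises when the series of all powers \<open>n ^ j\<close> are brought
  to the common denominator \<open>(1 - z) ^ (d + 1)\<close>.\<close>

definition hstar_of :: "nat \<Rightarrow> real poly \<Rightarrow> real poly" where
  "hstar_of d f = (\<Sum>j\<le>d. smult (coeff f j) (eulerian j * [:1, -1:] ^ (d - j)))"

lemma degree_hstar_of: "degree (hstar_of d f) \<le> d"
  unfolding hstar_of_def
proof (rule degree_sum_le)
  fix j assume "j \<in> {..d}"
  then have "degree ([:1, -1:] ^ (d - j) :: real poly) \<le> d - j" "j \<le> d"
    using degree_power_le[of "[:1, -1 :: real:]" "d - j"] by simp_all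
  then have "degree (eulerian j * [:1, -1:] ^ (d - j)) \<le> d"
    using degree_mult_le[of "eulerian j" "[:1, -1:] ^ (d - j)"] degree_eulerian[of j]
    by linarith
  then show "degree (smult (coeff f j) (eulerian j * [:1, -1:] ^ (d - j))) \<le> d"
    using degree_smult_le order.trans by blast
qed simp

lemma poly_eq_sum_atMost: "degree p \<le> n \<Longrightarrow> poly p x = (\<Sum>i\<le>n. coeff p i * x ^ i)"
  for p :: "real poly"
  unfolding poly_altdef by (rule sum.mono_neutral_left) (auto simp: coeff_eq_0)

lemma hstar_of_fps:
  assumes "degree f \<le> d"
  shows "Abs_fps (\<lambda>n. poly f (real n)) * (1 - fps_X) ^ (d + 1) = fps_of_poly (hstar_of d f)"
proof -
  let ?Q = "1 - fps_X :: real fps"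
  have Q: "fps_of_poly [:1, -1:] = ?Q"
    by (rule fps_ext) (auto simp: coeff_pCons split: nat.splits)
  have "Abs_fps (\<lambda>n. poly f (real n)) = (\<Sum>j\<le>d. fps_const (coeff f j) * Abs_fps (\<lambda>n. real n ^ j))"
    by (rule fps_ext) (simp add: fps_sum_nth poly_eq_sum_atMost[OF assms])
  then have "Abs_fps (\<lambda>n. poly f (real n)) * ?Q ^ (d + 1) =
      (\<Sum>j\<le>d. fps_const (coeff f j) * (Abs_fps (\<lambda>n. real n ^ j) * ?Q ^ (d + 1)))"
    by (simp add: sum_distrib_right mult.assoc)
  also have "\<dots> = (\<Sum>j\<le>d. fps_const (coeff f j) * (fps_of_poly (eulerian j) * ?Q ^ (d - j)))"
  proof (rule sum.cong[OF refl])
    fix j assume "j \<in> {..d}"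
    then have "?Q ^ (d + 1) = ?Q ^ (j + 1) * ?Q ^ (d - j)" by (simp flip: power_add)
    then have "Abs_fps (\<lambda>n. real n ^ j) * ?Q ^ (d + 1) = fps_of_poly (eulerian j) * ?Q ^ (d - j)"
      using eulerian_fps[of j] by (metis mult.assoc)
    then show "fps_const (coeff f j) * (Abs_fps (\<lambda>n. real n ^ j) * ?Q ^ (d + 1)) =
        fps_const (coeff f j) * (fps_of_poly (eulerian j) * ?Q ^ (d - j))" by simp
  qed
  also have "\<dots> = fps_of_poly (hstar_of d f)"
    by (simp add: hstar_of_def fps_of_poly_sum fps_of_poly_smult fps_of_poly_mult fps_of_poly_power Q)
  finally show ?thesis .
qed

lemma mixed_hstar_eq:
  fixes P :: "nat \<Rightarrow> (real ^ 'd) set"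
  assumes "degree (mixed_ehrhart_poly k P) \<le> CARD('d)"
  shows "mixed_hstar k P = coeff (hstar_of CARD('d) (mixed_ehrhart_poly k P))"
    and "mixed_hstar_poly k P = hstar_of CARD('d) (mixed_ehrhart_poly k P)"
proof -
  let ?H = "hstar_of CARD('d) (mixed_ehrhart_poly k P)"
  have 0: "coeff ?H i = 0" if "i > CARD('d)" for i
    using degree_hstar_of[of "CARD('d)"] that by (intro coeff_eq_0) (meson le_less_trans)
  have fps: "Abs_fps (coeff ?H) = fps_of_poly ?H" by (simp add: fps_of_poly_def)
  show 1: "mixed_hstar k P = coeff ?H"
    unfolding mixed_hstar_def
  proof (rule the_equality)
    show "(\<forall>i>CARD('d). coeff ?H i = 0) \<and> (\<forall>n. poly (mixed_ehrhart_poly k P) (real n) =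
        (\<Sum>i\<le>CARD('d). coeff ?H i * real (n + CARD('d) - i choose CARD('d))))"
      using 0 binomial_basis_iff_fps[of "CARD('d)" "coeff ?H" "\<lambda>n. poly (mixed_ehrhart_poly k P) (real n)"]
        hstar_of_fps[OF assms] fps by simp
    fix h assume h: "(\<forall>i>CARD('d). h i = 0) \<and> (\<forall>n. poly (mixed_ehrhart_poly k P) (real n) =
        (\<Sum>i\<le>CARD('d). h i * real (n + CARD('d) - i choose CARD('d))))"
    then have "Abs_fps h = Abs_fps (coeff ?H)"
      using binomial_basis_iff_fps[of "CARD('d)" h "\<lambda>n. poly (mixed_ehrhart_poly k P) (real n)"]
        hstar_of_fps[OF assms] fps by simp
    then show "h = coeff ?H" by (metis fps_nth_Abs_fps ext)
  qed
  show "mixed_hstar_poly k P = ?H"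
    unfolding mixed_hstar_poly_def 1 by (rule poly_as_sum_of_monoms'[OF degree_hstar_of])
qed

section \<open>Real roots by sign changes\<close>

lemma poly_linear_factors:
  "poly (smult c (\<Prod>i<e. [:- y i, 1:])) x = c * (\<Prod>i<e. x - y i)" for c :: real
  by (simp add: poly_prod)

lemma coeff_linear_factors:
  fixes y :: "nat \<Rightarrow> real"
  shows "degree (\<Prod>i<e. [:- y i, 1:]) = e" "coeff (\<Prod>i<e. [:- y i, 1:]) e = 1"
proof -
  show 1: "degree (\<Prod>i<e. [:- y i, 1:]) = e" by (simp add: degree_prod_eq_sum_degree)
  have "lead_coeff (\<Prod>i<e. [:- y i, 1:]) = 1" by (simp add: lead_coeff_prod)
  then show "coeff (\<Prod>i<e. [:- y i, 1:]) e = 1" using 1 by simp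
qed

text \<open>The difference of the two sides vanishes at \<open>e\<close> points, but its degree is
  below \<open>e\<close> because the coefficients at \<open>e\<close> cancel.\<close>

lemma poly_eq_linear_factors:
  fixes p :: "real poly"
  assumes deg: "degree p \<le> e" and root: "\<And>i. i < e \<Longrightarrow> poly p (y i) = 0" and inj: "inj_on y {..<e}"
  shows "p = smult (coeff p e) (\<Prod>i<e. [:- y i, 1:])"
proof (rule ccontr)
  define q where "q = p - smult (coeff p e) (\<Prod>i<e. [:- y i, 1:])"
  assume "p \<noteq> smult (coeff p e) (\<Prod>i<e. [:- y i, 1:])"
  then have q0: "q \<noteq> 0" by (simp add: q_def)
  have dq: "degree q \<le> e"
    unfolding q_def by (intro degree_diff_le deg order.trans[OF degree_smult_le]) (simp add: coeff_linear_factors)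
  have cq: "coeff q e = 0" by (simp add: q_def coeff_linear_factors)
  have "e \<noteq> 0"
  proof
    assume "e = 0"
    then have "degree q = 0" using dq by simp
    then show False using cq q0 \<open>e = 0\<close> leading_coeff_0_iff[of q] by simp
  qed
  then have "degree q < e" using dq cq q0 leading_coeff_0_iff[of q] le_neq_implies_less by metis
  have "y ` {..<e} \<subseteq> {x. poly q x = 0}"
    using root by (auto simp: q_def poly_prod)
  then have "card (y ` {..<e}) \<le> card {x. poly q x = 0}"
    by (intro card_mono poly_roots_finite q0)
  also have "\<dots> \<le> degree q" by (rule card_poly_roots_bound[OF q0])
  finally show False using \<open>degree q < e\<close> inj by (simp add: card_image)
qed

lemma interlaced_strict_mono:
  fixes x y :: "nat \<Rightarrow> real"
  assumes y: "\<And>i. i < e \<Longrightarrow> x i < y i \<and> y i < x (Suc i)"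
  shows "strict_mono_on {..<e} y"
proof -
  have mono: "x i \<le> x j" if "i \<le> j" "j \<le> e" for i j
    using that
  proof (induction j rule: dec_induct)
    case (step n)
    then show ?case using y[of n] by simp
  qed simp
  show ?thesis
  proof (rule strict_mono_onI)
    fix i j assume "i \<in> {..<e}" "j \<in> {..<e}" "i < j"
    then show "y i < y j" using y[of i] y[of j] mono[of "Suc i" j] by simp
  qed
qed

text \<open>The normalisation of the signs is that of a polynomial with positive leading coefficient.\<close>

lemma alternating_signs_imp_roots:
  fixes p :: "real poly" and x :: "nat \<Rightarrow> real"
  assumes deg: "degree p \<le> e" and inc: "\<And>i. i < e \<Longrightarrow> x i < x (Suc i)"
    and sgn: "\<And>i. i \<le> e \<Longrightarrow> 0 < (-1) ^ (e - i) * poly p (x i)"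
  shows "\<exists>y. (\<forall>i<e. x i < y i \<and> y i < x (Suc i)) \<and> p = smult (coeff p e) (\<Prod>i<e. [:- y i, 1:])"
proof -
  have "\<exists>z. x i < z \<and> z < x (Suc i) \<and> poly p z = 0" if i: "i < e" for i
  proof -
    have "e - i = Suc (e - Suc i)" using i by simp
    then have "0 < - ((-1) ^ (e - Suc i) * poly p (x i))" "0 < (-1) ^ (e - Suc i) * poly p (x (Suc i))"
      using sgn[of i] sgn[of "Suc i"] i by simp_all
    then have "poly p (x i) < 0 \<and> 0 < poly p (x (Suc i)) \<or> 0 < poly p (x i) \<and> poly p (x (Suc i)) < 0"
      by (cases "even (e - Suc i)") auto
    then show ?thesis using poly_IVT_pos[OF inc[OF i]] poly_IVT_neg[OF inc[OF i]] by blast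
  qed
  then obtain y where y: "\<And>i. i < e \<Longrightarrow> x i < y i \<and> y i < x (Suc i) \<and> poly p (y i) = 0" by metis
  then have "strict_mono_on {..<e} y" by (intro interlaced_strict_mono[of e x]) simp
  then have "inj_on y {..<e}" by (rule strict_mono_on_imp_inj_on)
  then show ?thesis using poly_eq_linear_factors[OF deg, of y] y by blast
qed

lemma sign_linear_factors:
  fixes y :: "nat \<Rightarrow> real"
  assumes "i \<le> e" "\<And>l. l < i \<Longrightarrow> y l < t" "\<And>l. i \<le> l \<Longrightarrow> l < e \<Longrightarrow> t < y l"
  shows "0 < (-1) ^ (e - i) * (\<Prod>l<e. t - y l)"
proof -
  have "(\<Prod>l<e. t - y l) = (\<Prod>l\<in>{..<i}. t - y l) * (\<Prod>l\<in>{i..<e}. t - y l)"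
    using assms(1) by (subst prod.union_disjoint[symmetric]) (auto intro!: prod.cong)
  also have "(\<Prod>l\<in>{i..<e}. t - y l) = (\<Prod>l\<in>{i..<e}. - (y l - t))" by simp
  also have "\<dots> = (-1) ^ (e - i) * (\<Prod>l\<in>{i..<e}. y l - t)"
    by (simp only: prod_uminus card_atLeastLessThan)
  finally have "(-1) ^ (e - i) * (\<Prod>l<e. t - y l) = (\<Prod>l\<in>{..<i}. t - y l) * (\<Prod>l\<in>{i..<e}. y l - t)"
    by (simp flip: power_mult_distrib add: mult_ac)
  moreover have "0 < (\<Prod>l\<in>{..<i}. t - y l)" "0 < (\<Prod>l\<in>{i..<e}. y l - t)"
    using assms by (auto intro!: prod_pos)
  ultimately show ?thesis by simp
qed

text \<open>Reflecting the argument and correcting the sign reduces this to the behaviour at plus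
  infinity.\<close>

lemma sign_at_minus_infinity:
  fixes p :: "real poly"
  assumes "lead_coeff p > 0"
  shows "\<exists>t<b. 0 < (-1) ^ degree p * poly p t"
proof -
  define q where "q = smult ((-1) ^ degree p) (pcompose p [:0, -1:])"
  have "lead_coeff q = lead_coeff p"
    by (simp add: q_def lead_coeff_comp flip: power_mult_distrib)
  then obtain N where N: "\<And>x. x \<ge> N \<Longrightarrow> lead_coeff p \<le> poly q x"
    using poly_pinfty_gt_lc[of q] assms by auto
  define s where "s = max N (1 - b)"
  have "0 < poly q s" using N[of s] assms by (simp add: s_def)
  then show ?thesis
    by (intro exI[of _ "- s"]) (auto simp: q_def poly_pcompose s_def)
qed

text \<open>At a root of the preceding Eulerian polynomial the recurrence leaves only
  \<open>1 - z\<close> times its derivative, and the derivative alternates in sign along simple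
  roots. A further sign change lies to the left of all of them.\<close>

lemma reduced_eulerian_roots:
  "\<exists>y. (\<forall>i<n. y i < 0) \<and> strict_mono_on {..<n} y \<and> reduced_eulerian n = (\<Prod>i<n. [:- y i, 1:])"
proof (induction n)
  case 0
  have "reduced_eulerian 0 = 1" by (simp add: reduced_eulerian_def pderiv_1)
  then show ?case by simp
next
  case (Suc n)
  then obtain y where y: "\<And>i. i < n \<Longrightarrow> y i < 0" "strict_mono_on {..<n} y"
    "reduced_eulerian n = (\<Prod>i<n. [:- y i, 1:])" by blast
  \<comment> \<open>The roots of \<open>eulerian (Suc n)\<close>: those of the reduced polynomial,
    and 0 as the largest.\<close>
  define z where "z i = (if i < n then y i else 0)" for i
  have z_less: "z i < z j" if "i < j" "j \<le> n" for i j
    using that y(1) strict_mono_onD[OF y(2)] by (auto simp: z_def)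
  have A: "eulerian (Suc n) = (\<Prod>i<Suc n. [:- z i, 1:])"
  proof -
    have "(\<Prod>i<Suc n. [:- z i, 1:]) = (\<Prod>i<n. [:- y i, 1:]) * [:0, 1:]" by (simp add: z_def)
    also have "\<dots> = eulerian (Suc n)" unfolding eulerian_Suc y(3) by simp
    finally show ?thesis ..
  qed
  let ?p = "reduced_eulerian (Suc n)"
  have sgn_z: "0 < (-1) ^ (n - i) * poly ?p (z i)" if i: "i \<le> n" for i
  proof -
    let ?R = "\<Prod>l\<in>{..<Suc n} - {i}. [:- z l, 1:]"
    have "eulerian (Suc n) = [:- z i, 1:] * ?R"
      unfolding A using i by (intro prod.remove) auto
    then have "poly ?p (z i) = (1 - z i) * poly ?R (z i)"
      by (simp only: reduced_eulerian_def pderiv_mult pderiv_pCons poly_add poly_mult poly_smult) (simp add: algebra_simps)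
    also have "poly ?R (z i) = (\<Prod>l\<in>{..<i}. z i - z l) * (\<Prod>l\<in>{i<..n}. z i - z l)"
      unfolding poly_prod using i by (subst prod.union_disjoint[symmetric]) (auto intro!: prod.cong)
    also have "(\<Prod>l\<in>{i<..n}. z i - z l) = (\<Prod>l\<in>{i<..n}. - (z l - z i))" by simp
    also have "\<dots> = (-1) ^ (n - i) * (\<Prod>l\<in>{i<..n}. z l - z i)"
      by (simp only: prod_uminus card_greaterThanAtMost)
    finally have "(-1) ^ (n - i) * poly ?p (z i) =
        (1 - z i) * (\<Prod>l\<in>{..<i}. z i - z l) * (\<Prod>l\<in>{i<..n}. z l - z i)"
      by (simp flip: power_mult_distrib add: mult_ac)
    moreover have "0 < (\<Prod>l\<in>{..<i}. z i - z l)" "0 < (\<Prod>l\<in>{i<..n}. z l - z i)"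
      using i z_less by (auto intro!: prod_pos)
    moreover have "z i < 1" using i y(1)[of i] by (auto simp: z_def)
    ultimately show ?thesis by simp
  qed
  have deg: "degree ?p = Suc n"
    using degree_reduced_eulerian[of "Suc n"] by (intro antisym le_degree) auto
  then have "lead_coeff ?p > 0" using degree_reduced_eulerian(2)[of "Suc n"] by simp
  from sign_at_minus_infinity[OF this, of "z 0"] obtain t where
    t: "t < z 0" "0 < (-1) ^ Suc n * poly ?p t" by (auto simp: deg)
  \<comment> \<open>Putting \<open>t\<close> in front gives \<open>n + 2\<close> points of
    alternating sign, enough for all \<open>n + 1\<close> roots.\<close>
  define x where "x i = (case i of 0 \<Rightarrow> t | Suc j \<Rightarrow> z j)" for i
  have inc: "x i < x (Suc i)" if "i < Suc n" for i
    using that t(1) z_less by (cases i) (auto simp: x_def)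
  have "0 < (-1) ^ (Suc n - i) * poly ?p (x i)" if "i \<le> Suc n" for i
    using that t(2) sgn_z by (cases i) (auto simp: x_def)
  from alternating_signs_imp_roots[OF _ inc this] deg obtain u where
    u: "\<forall>i<Suc n. x i < u i \<and> u i < x (Suc i)" "?p = smult (coeff ?p (Suc n)) (\<Prod>i<Suc n. [:- u i, 1:])"
    by auto
  have "u i < 0" if "i < Suc n" for i
    using u(1) that y(1)[of i] by (force simp: x_def z_def split: if_splits)
  moreover have "strict_mono_on {..<Suc n} u" by (rule interlaced_strict_mono[of _ x]) (use u(1) in blast)
  moreover have "?p = (\<Prod>i<Suc n. [:- u i, 1:])"
    using u(2) degree_reduced_eulerian(2)[of "Suc n"] by simp
  ultimately show ?case by blast
qed

text \<open>The limit alternates in sign at finitely many points that separate its roots. Pointwise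
  convergence preserves these signs eventually, and the degree bound leaves no room for further
  roots. Sign changes near each \<open>y i\<close> give the convergence.\<close>

lemma real_rooted_perturbation:
  fixes g :: "nat \<Rightarrow> real poly" and y :: "nat \<Rightarrow> real"
  assumes y: "strict_mono_on {..<e} y" "\<And>i. i < e \<Longrightarrow> y i < 0"
    and deg: "\<And>r. degree (g r) \<le> e" and c: "c > 0"
    and lim: "\<And>x. (\<lambda>r. poly (g r) x) \<longlonglongrightarrow> c * (\<Prod>i<e. x - y i)"
  shows "\<exists>R b. (\<forall>r\<ge>R. coeff (g r) e > 0 \<and> strict_mono_on {..<e} (b r) \<and> (\<forall>i<e. b r i < 0) \<and>
      g r = smult (coeff (g r) e) (\<Prod>i<e. [:- b r i, 1:])) \<and>
    (\<forall>i<e. (\<lambda>r. b r i) \<longlonglongrightarrow> y i)"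
proof -
  have y_less: "y i < y j" if "i < j" "j < e" for i j
    using strict_mono_onD[OF y(1), of i j] that by simp
  \<comment> \<open>Midpoints separate neighbouring roots. The last point is 0, which keeps the
    perturbed roots negative and gives the sign of the leading coefficient.\<close>
  define x where "x i = (if i = e then 0 else if i = 0 then y 0 - 1 else (y (i - 1) + y i) / 2)" for i
  have xy: "x i < y i \<and> y i < x (Suc i)" if "i < e" for i
    using that y(2) y_less[of "i - 1" i] y_less[of i "Suc i"]
    by (cases "Suc i = e") (auto simp: x_def field_simps)
  have xinc: "x i < x (Suc i)" if "i < e" for i using xy[OF that] by linarith
  have xmono: "x i \<le> x j" if "i \<le> j" "j \<le> e" for i j
    using that
  proof (induction j rule: dec_induct)
    case (step n)
    then show ?case using xinc[of n] by simp
  qed simp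
  have sign: "\<forall>\<^sub>F r in sequentially. 0 < (-1) ^ (e - i) * poly (g r) t"
    if "i \<le> e" "\<And>l. l < i \<Longrightarrow> y l < t" "\<And>l. i \<le> l \<Longrightarrow> l < e \<Longrightarrow> t < y l" for i t
  proof -
    have "(\<lambda>r. (-1) ^ (e - i) * poly (g r) t) \<longlonglongrightarrow> (-1) ^ (e - i) * (c * (\<Prod>i<e. t - y i))"
      by (intro tendsto_intros lim)
    moreover have "0 < (-1) ^ (e - i) * (c * (\<Prod>i<e. t - y i))"
      using sign_linear_factors[OF that] c by (simp add: mult.left_commute)
    ultimately show ?thesis by (rule order_tendstoD)
  qed
  have below: "y l < x i" if "l < i" "i \<le> e" for l i
    using xy[of l] xmono[of "Suc l" i] that by simp
  have above: "x i < y l" if "i \<le> l" "l < e" for l i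
    using xy[of l] xmono[of i l] that by simp
  have "\<forall>\<^sub>F r in sequentially. \<forall>i\<in>{..e}. 0 < (-1) ^ (e - i) * poly (g r) (x i)"
    by (intro eventually_ball_finite ballI sign) (use below above in auto)
  then obtain R where R: "\<And>r i. r \<ge> R \<Longrightarrow> i \<le> e \<Longrightarrow> 0 < (-1) ^ (e - i) * poly (g r) (x i)"
    by (auto simp: eventually_sequentially)
  have "\<exists>b. (\<forall>i<e. x i < b i \<and> b i < x (Suc i)) \<and> g r = smult (coeff (g r) e) (\<Prod>i<e. [:- b i, 1:])"
    if "r \<ge> R" for r
    by (rule alternating_signs_imp_roots[OF deg xinc R[OF that]])
  then obtain b where b: "\<And>r i. r \<ge> R \<Longrightarrow> i < e \<Longrightarrow> x i < b r i \<and> b r i < x (Suc i)"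
    and gb: "\<And>r. r \<ge> R \<Longrightarrow> g r = smult (coeff (g r) e) (\<Prod>i<e. [:- b r i, 1:])" by metis
  have bneg: "b r i < 0" if "r \<ge> R" "i < e" for r i
    using b[OF that] xmono[of "Suc i" e] that by (simp add: x_def)
  have "strict_mono_on {..<e} (b r)" if "r \<ge> R" for r
    by (rule interlaced_strict_mono[of _ x]) (use b that in blast)
  moreover have "coeff (g r) e > 0" if r: "r \<ge> R" for r
  proof -
    have "0 < poly (g r) 0" using R[OF r, of e] by (simp add: x_def)
    also have "poly (g r) 0 = coeff (g r) e * (\<Prod>i<e. 0 - b r i)"
      by (subst gb[OF r]) (rule poly_linear_factors)
    finally show ?thesis
      using prod_pos[of "{..<e}" "\<lambda>i. 0 - b r i"] bneg[OF r] by (simp add: zero_less_mult_iff)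
  qed
  moreover have "(\<lambda>r. b r i) \<longlonglongrightarrow> y i" if i: "i < e" for i
  proof (rule order_tendstoI)
    \<comment> \<open>Opposite signs at \<open>s\<close> and \<open>t\<close> give a root between
      them; it can only be \<open>b r i\<close>, because the other roots lie in other gaps of
      \<open>x\<close>.\<close>
    have close: "\<forall>\<^sub>F r in sequentially. s < b r i \<and> b r i < t"
      if st: "x i < s" "s < y i" "y i < t" "t < x (Suc i)" for s t
    proof -
      have yl: "l < i \<Longrightarrow> y l < s" "Suc i \<le> l \<Longrightarrow> l < e \<Longrightarrow> t < y l" for l
        using below[of l i] above[of "Suc i" l] st i by auto
      have s: "\<forall>\<^sub>F r in sequentially. 0 < (-1) ^ (e - i) * poly (g r) s"
        by (rule sign) (use i yl y_less st in \<open>force simp: le_less\<close>)+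
      have t: "\<forall>\<^sub>F r in sequentially. 0 < (-1) ^ (e - Suc i) * poly (g r) t"
        by (rule sign) (use i yl y_less st in \<open>force simp: less_Suc_eq\<close>)+
      show ?thesis using s t eventually_ge_at_top[of R]
      proof eventually_elim
        case (elim r)
        have "e - i = Suc (e - Suc i)" using i by simp
        then have "poly (g r) s < 0 \<and> 0 < poly (g r) t \<or> 0 < poly (g r) s \<and> poly (g r) t < 0"
          using elim(1,2) by (cases "even (e - Suc i)") auto
        then obtain u where u: "s < u" "u < t" "poly (g r) u = 0"
          using poly_IVT_pos[of s t "g r"] poly_IVT_neg[of s t "g r"] st by auto
        then have "coeff (g r) e * (\<Prod>l<e. u - b r l) = 0"
          using poly_linear_factors[where c = "coeff (g r) e" and e = e and y = "b r" and x = u]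
            gb[OF elim(3)] by simp
        then obtain l where l: "l < e" "u = b r l"
          using \<open>\<And>r. r \<ge> R \<Longrightarrow> coeff (g r) e > 0\<close>[OF elim(3)] by auto
        have "l = i"
        proof (rule ccontr)
          assume "l \<noteq> i"
          then consider "l < i" | "i < l" by linarith
          then show False
            using b[OF elim(3) l(1)] u st l xmono[of "Suc l" i] xmono[of "Suc i" l] i by cases auto
        qed
        then show ?case using u l by simp
      qed
    qed
    fix a
    show "\<forall>\<^sub>F r in sequentially. a < b r i" if "a < y i"
    proof -
      have "\<forall>\<^sub>F r in sequentially. (max a (x i) + y i) / 2 < b r i \<and> b r i < (y i + x (Suc i)) / 2"
        by (rule close) (use that xy[OF i] in auto)
      then show ?thesis by eventually_elim (use that in auto)
    qed
    show "\<forall>\<^sub>F r in sequentially. b r i < a" if "y i < a"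
    proof -
      have "\<forall>\<^sub>F r in sequentially. (x i + y i) / 2 < b r i \<and> b r i < (y i + min a (x (Suc i))) / 2"
        by (rule close) (use that xy[OF i] in auto)
      then show ?thesis by eventually_elim (use that in auto)
    qed
  qed
  ultimately show ?thesis using bneg gb by blast
qed

section \<open>Complex zeros, log-concavity and unimodality\<close>

lemma map_poly_of_real_mult:
  "map_poly complex_of_real (p * q) = map_poly complex_of_real p * map_poly complex_of_real q"
  by (rule poly_eqI) (simp add: coeff_map_poly coeff_mult)

lemma map_poly_of_real_linear_factors:
  "map_poly complex_of_real (\<Prod>i\<in>A. [:- y i, 1:]) = (\<Prod>i\<in>A. [:- complex_of_real (y i), 1:])"
proof (induction A rule: infinite_finite_induct)
  case (insert i A)
  have "map_poly complex_of_real [:- y i, 1:] = [:- complex_of_real (y i), 1:]"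
    by (simp add: map_poly_pCons)
  then show ?case by (simp only: prod.insert[OF insert(1,2)] map_poly_of_real_mult insert(3))
qed simp_all

text \<open>Passes from roots indexed from 0 to the indexing from 1 of
  \<open>ordered_real_roots\<close>, with the root 0 in the last place.\<close>

lemma ordered_real_roots_pCons:
  assumes c: "c \<noteq> 0" and y: "strict_mono_on {..<e} y" "\<And>i. i < e \<Longrightarrow> y i < 0"
  shows "ordered_real_roots (pCons 0 (smult c (\<Prod>i<e. [:- y i, 1:]))) (Suc e)
    (\<lambda>i. if i = Suc e then 0 else y (i - 1))"
proof -
  let ?x = "\<lambda>i. if i = Suc e then 0 else y (i - 1)"
  have "poly (map_poly complex_of_real (pCons 0 (smult c (\<Prod>i<e. [:- y i, 1:])))) z =
      z * (of_real c * (\<Prod>i<e. z - of_real (y i)))" for z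
    by (simp add: map_poly_pCons map_poly_smult map_poly_of_real_linear_factors poly_prod)
  then have "{z. poly (map_poly complex_of_real (pCons 0 (smult c (\<Prod>i<e. [:- y i, 1:])))) z = 0} =
      insert 0 ((\<lambda>i. complex_of_real (y i)) ` {..<e})"
    using c by auto
  also have "\<dots> = (\<lambda>i. complex_of_real (?x i)) ` {1..Suc e}"
  proof -
    have "{1..Suc e} = insert (Suc e) (Suc ` {..<e})"
      by (auto simp: image_iff) (metis Suc_le_D Suc_le_eq less_Suc_eq_le le_SucE lessThan_iff not_less_eq_eq)
    then show ?thesis by (simp add: image_image del: atLeastAtMost_insertL cong: image_cong_simp)
  qed
  finally have "{z. poly (map_poly complex_of_real (pCons 0 (smult c (\<Prod>i<e. [:- y i, 1:])))) z = 0} =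
      (\<lambda>i. complex_of_real (?x i)) ` {1..Suc e}" .
  moreover have "strict_mono_on {1..Suc e} ?x"
  proof (rule strict_mono_onI)
    fix i j assume ij: "i \<in> {1..Suc e}" "j \<in> {1..Suc e}" "i < j"
    then show "?x i < ?x j"
      using y(2)[of "i - 1"] strict_mono_onD[OF y(1), of "i - 1" "j - 1"] by auto
  qed
  ultimately show ?thesis by (simp add: ordered_real_roots_def)
qed

text \<open>Multiplication by a factor \<open>X + a\<close> with \<open>a > 0\<close> preserves log-concavity.\<close>

lemma linear_factors_log_concave:
  fixes y :: "nat \<Rightarrow> real"
  assumes "\<And>i. i < e \<Longrightarrow> y i < 0"
  shows "(\<forall>i\<le>e. coeff (\<Prod>i<e. [:- y i, 1:]) i > 0) \<and>
    (\<forall>i. coeff (\<Prod>i<e. [:- y i, 1:]) i * coeff (\<Prod>i<e. [:- y i, 1:]) (i + 2)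
      \<le> (coeff (\<Prod>i<e. [:- y i, 1:]) (i + 1))\<^sup>2)"
  using assms
proof (induction e)
  case 0
  then show ?case by simp
next
  case (Suc e)
  let ?p = "\<Prod>i<e. [:- y i, 1:]"
  define c where "c = coeff ?p"
  define a where "a = - y e"
  have a: "a > 0" using Suc.prems by (simp add: a_def)
  have pos: "\<And>i. i \<le> e \<Longrightarrow> c i > 0" and lc: "\<And>i. c i * c (i + 2) \<le> (c (i + 1))\<^sup>2"
    using Suc by (auto simp: c_def)
  have c0: "c i = 0" if "i > e" for i
    using that by (simp add: c_def coeff_eq_0 coeff_linear_factors)
  have nonneg: "0 \<le> c i" for i using pos[of i] c0[of i] by (cases "i \<le> e") auto
  have eq: "(\<Prod>i<Suc e. [:- y i, 1:]) = [:a, 1:] * ?p" by (simp add: a_def mult.commute)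
  define b where "b = coeff ([:a, 1:] * ?p)"
  have c0': "b 0 = a * c 0" by (simp add: b_def c_def)
  have cS: "b (Suc i) = a * c (Suc i) + c i" for i by (simp add: b_def c_def)
  \<comment> \<open>Multiply two neighbouring log-concavity inequalities and cancel the positive
    middle product; beyond degree \<open>e\<close> the left side is 0.\<close>
  have cross: "c i * c (i + 3) \<le> c (i + 1) * c (i + 2)" for i
  proof (cases "i + 3 \<le> e")
    case True
    have "(c i * c (i + 2)) * (c (i + 1) * c (i + 3)) \<le> (c (i + 1))\<^sup>2 * (c (i + 2))\<^sup>2"
      using lc[of i] lc[of "i + 1"] nonneg by (intro mult_mono) (auto simp: numeral_eq_Suc)
    then have "(c (i + 1) * c (i + 2)) * (c i * c (i + 3)) \<le> (c (i + 1) * c (i + 2)) * (c (i + 1) * c (i + 2))"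
      by (simp add: power2_eq_square mult_ac)
    moreover have "0 < c (i + 1) * c (i + 2)" using pos True by simp
    ultimately show ?thesis by (rule mult_left_le_imp_le)
  qed (use c0 nonneg in simp)
  have "b i > 0" if "i \<le> Suc e" for i
    using that a pos nonneg c0 by (cases i) (auto simp: c0' cS intro: add_nonneg_pos)
  moreover have "b i * b (i + 2) \<le> (b (i + 1))\<^sup>2" for i
  \<comment> \<open>The lowest coefficient \<open>b 0\<close> has only one summand, so
    \<open>i = 0\<close> is treated on its own.\<close>
  proof (cases i)
    case 0
    have "a\<^sup>2 * (c 0 * c 2) \<le> a\<^sup>2 * (c 1)\<^sup>2" using lc[of 0] by (intro mult_left_mono) (auto simp: numeral_eq_Suc)
    moreover have "0 \<le> a * (c 0 * c 1)" "0 \<le> (c 0)\<^sup>2" using a nonneg by auto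
    moreover have "(a * c 1 + c 0)\<^sup>2 - (a * c 0) * (a * c 2 + c 1) =
        (a\<^sup>2 * (c 1)\<^sup>2 - a\<^sup>2 * (c 0 * c 2)) + a * (c 0 * c 1) + (c 0)\<^sup>2"
      by (simp add: power2_eq_square algebra_simps)
    ultimately have "(a * c 0) * (a * c 2 + c 1) \<le> (a * c 1 + c 0)\<^sup>2" by linarith
    then show ?thesis using 0 cS[of 0] cS[of 1] by (simp add: c0' numeral_eq_Suc)
  next
    case (Suc j)
    have 1: "a\<^sup>2 * (c (j + 1) * c (j + 3)) \<le> a\<^sup>2 * (c (j + 2))\<^sup>2"
      using lc[of "j + 1"] by (intro mult_left_mono) (auto simp: numeral_eq_Suc)
    have 2: "a * (c j * c (j + 3)) \<le> a * (c (j + 1) * c (j + 2))"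
      using cross[of j] a by (intro mult_left_mono) auto
    \<comment> \<open>Compared by powers of \<open>a\<close>, the terms of order 2, 1 and 0 are
      inequality 1, inequality 2 and log-concavity of \<open>c\<close>.\<close>
    have "(a * c (j + 1) + c j) * (a * c (j + 3) + c (j + 2)) \<le> (a * c (j + 2) + c (j + 1))\<^sup>2"
      using 1 2 lc[of j] by (simp add: power2_eq_square algebra_simps)
    then show ?thesis using Suc cS[of j] cS[of "j + 1"] cS[of "j + 2"] by (simp add: numeral_eq_Suc)
  qed
  ultimately show ?case unfolding eq b_def by blast
qed

text \<open>The peak \<open>l\<close> is the first place of descent. By log-concavity and positivity
  every descent is followed by a further one, ties allowed.\<close>

lemma unimodal_if_log_concave:
  assumes a0: "a 0 = 0" and pos: "\<And>i. 1 \<le> i \<Longrightarrow> i \<le> d \<Longrightarrow> a i > 0" and lc: "log_concave d a"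
  shows "unimodal d a"
proof -
  define l where "l = (LEAST i. i = d \<or> a (i + 1) < a i)"
  have l: "l = d \<or> a (l + 1) < a l" unfolding l_def by (rule LeastI[of _ d]) simp
  have "l \<le> d" unfolding l_def by (rule Least_le) simp
  moreover have "a i \<le> a (i + 1)" if "i < l" for i
    using not_less_Least[of i "\<lambda>i. i = d \<or> a (i + 1) < a i"] that by (auto simp: l_def)
  moreover have "a (i + 1) \<le> a i" if "i \<in> {l..<d}" for i
  proof -
    have "l \<le> i" "i < d" using that by auto
    then show ?thesis
    proof (induction i rule: dec_induct)
      case base
      then show ?case using l by auto
    next
      case (step n)
      then have IH: "a (n + 1) \<le> a n" by simp
      have p: "a (n + 1) > 0" "a (n + 2) \<ge> 0" using pos[of "n + 1"] pos[of "n + 2"] step by auto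
      have "a (n + 1) * a (n + 2) \<le> a n * a (n + 2)" using IH p by (intro mult_right_mono)
      also have "\<dots> \<le> (a (n + 1))\<^sup>2"
        using lc step by (auto simp: log_concave_def dest!: bspec[of _ _ "n + 1"])
      finally have "a (n + 1) * a (n + 2) \<le> a (n + 1) * a (n + 1)" by (simp add: power2_eq_square)
      then show ?case using p(1) by simp
    qed
  qed
  ultimately show ?thesis unfolding unimodal_def by blast
qed

section \<open>Large dilations\<close>

text \<open>Without constant term all Eulerian polynomials that occur share the factor
  \<open>z\<close>. After removal of \<open>z\<close> and \<open>r ^ Suc e\<close> only inverse
  powers of \<open>r\<close> remain.\<close>

lemma hstar_of_scaled:
  assumes f: "poly f 0 = 0" and r: "r > 0"
  shows "hstar_of (Suc e) (pcompose f [:0, r:]) = pCons 0 (smult (r ^ Suc e)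
    (\<Sum>j\<le>e. smult (coeff f (Suc j) * inverse r ^ (e - j)) (reduced_eulerian j * [:1, -1:] ^ (e - j))))"
proof -
  have c: "coeff (pcompose f [:0, r:]) j = r ^ j * coeff f j" for j
    by (rule coeff_pcompose_linear)
  have "hstar_of (Suc e) (pcompose f [:0, r:]) =
      (\<Sum>j\<le>e. smult (r ^ Suc j * coeff f (Suc j)) (eulerian (Suc j) * [:1, -1:] ^ (e - j)))"
    using f by (simp only: hstar_of_def sum.atMost_Suc_shift c) (simp add: poly_0_coeff_0)
  also have "\<dots> = (\<Sum>j\<le>e. [:0, 1:] * smult (r ^ Suc e)
      (smult (coeff f (Suc j) * inverse r ^ (e - j)) (reduced_eulerian j * [:1, -1:] ^ (e - j))))"
  proof (rule sum.cong[OF refl])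
    fix j assume "j \<in> {..e}"
    then have "r ^ Suc e = r ^ Suc j * r ^ (e - j)" by (simp flip: power_add)
    then have eq: "r ^ Suc e * (coeff f (Suc j) * inverse r ^ (e - j)) = r ^ Suc j * coeff f (Suc j)"
      using r by (simp add: power_inverse)
    show "smult (r ^ Suc j * coeff f (Suc j)) (eulerian (Suc j) * [:1, -1:] ^ (e - j)) =
        [:0, 1:] * smult (r ^ Suc e) (smult (coeff f (Suc j) * inverse r ^ (e - j))
          (reduced_eulerian j * [:1, -1:] ^ (e - j)))"
      unfolding eulerian_Suc smult_smult eq by simp
  qed
  also have "\<dots> = [:0, 1:] * smult (r ^ Suc e)
      (\<Sum>j\<le>e. smult (coeff f (Suc j) * inverse r ^ (e - j)) (reduced_eulerian j * [:1, -1:] ^ (e - j)))"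
    by (simp only: smult_sum_right sum_distrib_left)
  finally show ?thesis by simp
qed

text \<open>As the mixed Ehrhart polynomial vanishes at 0, so does \<open>h\<^sub>0\<close>; hence 0
  is always a root, and for large \<open>r\<close> it is the largest. The bound
  \<open>k \<le> CARD('d)\<close> leaves room for an independent edge of every colour, which makes
  the coefficient of \<open>n\<^sup>d\<close> positive.\<close>

theorem corollary4p6:
  fixes P :: "nat \<Rightarrow> (real ^ 'd) set" and k :: nat
  assumes "1 \<le> k" and "k \<le> CARD('d)"
    and "\<And>j. j \<in> {1..k} \<Longrightarrow> lattice_polytope (P j)"
    and "\<And>j. j \<in> {1..k} \<Longrightarrow> aff_dim (P j) = int CARD('d)"
  shows "\<exists>\<rho> :: nat \<Rightarrow> real.
    ordered_real_roots (eulerian_poly CARD('d)) CARD('d) \<rho> \<and> \<rho> CARD('d) = 0 \<and>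
    (\<exists>R > 0. \<exists>\<beta> :: nat \<Rightarrow> nat \<Rightarrow> real.
      (\<forall>r \<ge> R.
        ordered_real_roots (mixed_hstar_poly k (\<lambda>j. dilate r (P j))) CARD('d) (\<lambda>i. \<beta> i r) \<and>
        \<beta> CARD('d) r = 0 \<and>
        (\<forall>i \<in> {1..CARD('d)}. mixed_hstar k (\<lambda>j. dilate r (P j)) i > 0) \<and>
        log_concave CARD('d) (mixed_hstar k (\<lambda>j. dilate r (P j))) \<and>
        unimodal CARD('d) (mixed_hstar k (\<lambda>j. dilate r (P j)))) \<and>
      (\<forall>i \<in> {1..CARD('d)}. (\<lambda>r. \<beta> i r) \<longlonglongrightarrow> \<rho> i))"
proof -
  obtain f where f: "degree f \<le> CARD('d)" "poly f 0 = 0" "coeff f CARD('d) > 0"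
    and ME: "\<And>r. mixed_ehrhart_poly k (\<lambda>j. dilate r (P j)) = pcompose f [:0, real r:]"
    using mixed_ehrhart_poly_dilate[of k P, OF assms] by blast
  obtain e where e: "CARD('d) = Suc e" using zero_less_card_finite[where 'a = 'd] gr0_conv_Suc by blast
  obtain y where y: "\<And>i. i < e \<Longrightarrow> y i < 0" "strict_mono_on {..<e} y"
    "reduced_eulerian e = (\<Prod>i<e. [:- y i, 1:])"
    using reduced_eulerian_roots[of e] by blast
  define t where "t j = reduced_eulerian j * [:1, -1:] ^ (e - j)" for j
  define g where "g r = (\<Sum>j\<le>e. smult (coeff f (Suc j) * inverse (real r) ^ (e - j)) (t j))" for r
  have deg_t: "degree (t j) \<le> e" if "j \<le> e" for j
  proof -
    have "degree ([:1, -1:] ^ (e - j) :: real poly) \<le> e - j"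
      using degree_power_le[of "[:1, -1 :: real:]" "e - j"] by simp
    then show ?thesis
      using degree_mult_le[of "reduced_eulerian j" "[:1, -1:] ^ (e - j)"] degree_reduced_eulerian(1)[of j] that
      unfolding t_def by linarith
  qed
  have deg: "degree (g r) \<le> e" for r
    unfolding g_def by (intro degree_sum_le order.trans[OF degree_smult_le] deg_t) auto
  have lim: "(\<lambda>r. poly (g r) x) \<longlonglongrightarrow> coeff f (Suc e) * (\<Prod>i<e. x - y i)" for x
  proof -
    \<comment> \<open>The inverse powers of \<open>r\<close> tend to 0 except for
      \<open>j = e\<close>, where the exponent is 0.\<close>
    have "(\<lambda>r. \<Sum>j\<le>e. coeff f (Suc j) * inverse (real r) ^ (e - j) * poly (t j) x)
        \<longlonglongrightarrow> (\<Sum>j\<le>e. coeff f (Suc j) * 0 ^ (e - j) * poly (t j) x)"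
      by (intro tendsto_intros lim_inverse_n)
    also have "(\<Sum>j\<le>e. coeff f (Suc j) * 0 ^ (e - j) * poly (t j) x) =
        (\<Sum>j\<in>{e}. coeff f (Suc j) * 0 ^ (e - j) * poly (t j) x)"
      by (rule sum.mono_neutral_right) auto
    also have "\<dots> = coeff f (Suc e) * (\<Prod>i<e. x - y i)"
      by (simp add: t_def y(3) poly_prod)
    finally show ?thesis by (simp add: g_def poly_sum)
  qed
  have "coeff f (Suc e) > 0" using f(3) e by simp
  from real_rooted_perturbation[OF y(2,1) deg this lim] obtain R b where
    R: "\<And>r. r \<ge> R \<Longrightarrow> coeff (g r) e > 0 \<and> strict_mono_on {..<e} (b r) \<and> (\<forall>i<e. b r i < 0) \<and>
      g r = smult (coeff (g r) e) (\<Prod>i<e. [:- b r i, 1:])"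
    and lim_b: "\<And>i. i < e \<Longrightarrow> (\<lambda>r. b r i) \<longlonglongrightarrow> y i" by blast
  \<comment> \<open>The negative roots move to the places \<open>1\<close> to \<open>e\<close>, and
    the root from the factor \<open>z\<close> comes last.\<close>
  define \<rho> where "\<rho> i = (if i = Suc e then 0 else y (i - 1))" for i
  define \<beta> where "\<beta> i r = (if i = Suc e then 0 else b r (i - 1))" for i r
  have "ordered_real_roots (eulerian_poly CARD('d)) CARD('d) \<rho>"
    using ordered_real_roots_pCons[of 1 e y] y unfolding e eulerian_poly_eq eulerian_Suc \<rho>_def by simp
  moreover have "\<rho> CARD('d) = 0" by (simp add: \<rho>_def e)
  \<comment> \<open>The threshold \<open>max R 1\<close> keeps \<open>r\<close> positive, so that
    \<open>r ^ Suc e\<close> can be divided out.\<close>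
  moreover have "ordered_real_roots (mixed_hstar_poly k (\<lambda>j. dilate r (P j))) CARD('d) (\<lambda>i. \<beta> i r) \<and>
        \<beta> CARD('d) r = 0 \<and>
        (\<forall>i \<in> {1..CARD('d)}. mixed_hstar k (\<lambda>j. dilate r (P j)) i > 0) \<and>
        log_concave CARD('d) (mixed_hstar k (\<lambda>j. dilate r (P j))) \<and>
        unimodal CARD('d) (mixed_hstar k (\<lambda>j. dilate r (P j)))" if r: "r \<ge> max R 1" for r
  proof -
    define L where "L = real r ^ Suc e * coeff (g r) e"
    define h where "h = mixed_hstar k (\<lambda>j. dilate r (P j))"
    let ?q = "\<Prod>i<e. [:- b r i, 1:]"
    have L: "L > 0" using R[of r] r by (simp add: L_def)
    have b: "strict_mono_on {..<e} (b r)" "\<And>i. i < e \<Longrightarrow> b r i < 0" using R[of r] r by auto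
    have "degree (pcompose f [:0, real r:]) \<le> CARD('d)" using f(1) r by (simp add: degree_pcompose)
    then have deg_ME: "degree (mixed_ehrhart_poly k (\<lambda>j. dilate r (P j))) \<le> CARD('d)" by (simp add: ME)
    have "hstar_of (Suc e) (pcompose f [:0, real r:]) = pCons 0 (smult (real r ^ Suc e) (g r))"
      unfolding g_def t_def by (rule hstar_of_scaled[OF f(2)]) (use r in simp)
    also have "g r = smult (coeff (g r) e) ?q" using R[of r] r by simp
    finally have H: "hstar_of (Suc e) (pcompose f [:0, real r:]) = pCons 0 (smult L ?q)"
      by (simp add: L_def)
    have hpoly: "mixed_hstar_poly k (\<lambda>j. dilate r (P j)) = pCons 0 (smult L ?q)"
      and h: "h = coeff (pCons 0 (smult L ?q))"
      using mixed_hstar_eq[OF deg_ME] H unfolding h_def ME e by simp_all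
    have h0: "h 0 = 0" and hS: "h (Suc i) = L * coeff ?q i" for i by (simp_all add: h)
    have pos: "h i > 0" if i: "1 \<le> i" "i \<le> Suc e" for i
      using i linear_factors_log_concave[of e "b r"] b(2) L by (cases i) (auto simp: hS)
    have lc: "log_concave (Suc e) h"
      unfolding log_concave_def
    proof
      fix i assume "i \<in> {1..<Suc e}"
      then obtain j where j: "i = Suc j" by (cases i) auto
      show "h (i - 1) * h (i + 1) \<le> (h i)\<^sup>2"
      \<comment> \<open>At \<open>i = 1\<close> the left side contains \<open>h 0 = 0\<close>; for
        larger \<open>i\<close> the inequality comes from the linear factors.\<close>
      proof (cases j)
        case (Suc l)
        have "coeff ?q l * coeff ?q (l + 2) \<le> (coeff ?q (l + 1))\<^sup>2"
          using linear_factors_log_concave[of e "b r"] b(2) by blast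
        then have "L\<^sup>2 * (coeff ?q l * coeff ?q (l + 2)) \<le> L\<^sup>2 * (coeff ?q (l + 1))\<^sup>2"
          by (intro mult_left_mono) auto
        then show ?thesis by (simp add: j Suc hS power2_eq_square mult_ac)
      qed (simp add: j h0)
    qed
    have "unimodal (Suc e) h" by (rule unimodal_if_log_concave[OF h0 pos lc])
    moreover have "ordered_real_roots (pCons 0 (smult L ?q)) (Suc e) (\<lambda>i. \<beta> i r)"
      using ordered_real_roots_pCons[of L e "b r"] L b unfolding \<beta>_def by simp
    ultimately show ?thesis using pos lc unfolding hpoly e h_def[symmetric] by (simp add: \<beta>_def)
  qed
  moreover have "(\<lambda>r. \<beta> i r) \<longlonglongrightarrow> \<rho> i" if "i \<in> {1..CARD('d)}" for i
    using lim_b[of "i - 1"] that unfolding e \<beta>_def \<rho>_def by auto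
  ultimately show ?thesis
    by (intro exI[of _ \<rho>] conjI exI[of _ "max R 1"] exI[of _ \<beta>]) auto
qed

end
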